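(* There exists an analytic self-map $\phi\colon\mathbb{D}\to\mathbb{D}$ with $m(\{\xi\in\mathbb{T}: |\phi^\ast(\xi)|=1\})=0$ such that, for every $w\in H^2$, $w\not\equiv0$, for which $M_wC_\phi\colon f\mapsto w\,(f\circ\phi)$ is bounded on $H^2$, the operator $M_wC_\phi$ belongs to no Schatten class $S_p(H^2)$ with $p<\infty$.
   Context: $\mathbb{D}$ is the open unit disk, $\mathbb{T}=\partial\mathbb{D}$, $m$ the normalized Lebesgue measure on $\mathbb{T}$, $H^2$ the Hardy space, $\phi^\ast$ the radial limit function of $\phi$. $S_p(H^2)$, $p>0$, is the Schatten class of compact operators $T$ on $H^2$ with $\sum_n s_n(T)^p<\infty$. *)

theory Defs
  imports "HOL-Analysis.Analysis"
begin

definition taylor_coef :: "(complex \<Rightarrow> complex) \<Rightarrow> nat \<Rightarrow> complex" where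
  "taylor_coef f n = (deriv ^^ n) f 0 / of_nat (fact n)"

definition H2 :: "(complex \<Rightarrow> complex) set" where
  "H2 = {f. f holomorphic_on ball 0 1 \<and> summable (\<lambda>n. (norm (taylor_coef f n))\<^sup>2)}"

definition h2norm :: "(complex \<Rightarrow> complex) \<Rightarrow> real" where
  "h2norm f = sqrt (\<Sum>n. (norm (taylor_coef f n))\<^sup>2)"

definition H2_linear :: "((complex \<Rightarrow> complex) \<Rightarrow> (complex \<Rightarrow> complex)) \<Rightarrow> bool" where
  "H2_linear T \<longleftrightarrow>
     (\<forall>f\<in>H2. \<forall>g\<in>H2. \<forall>z\<in>ball 0 1. T (\<lambda>x. f x + g x) z = T f z + T g z) \<and>
     (\<forall>f\<in>H2. \<forall>c. \<forall>z\<in>ball 0 1. T (\<lambda>x. c * f x) z = c * T f z)"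

definition H2_bounded_op :: "((complex \<Rightarrow> complex) \<Rightarrow> (complex \<Rightarrow> complex)) \<Rightarrow> bool" where
  "H2_bounded_op T \<longleftrightarrow> H2_linear T \<and> (\<forall>f\<in>H2. T f \<in> H2) \<and>
     (\<exists>C. \<forall>f\<in>H2. h2norm (T f) \<le> C * h2norm f)"

definition H2_opnorm :: "((complex \<Rightarrow> complex) \<Rightarrow> (complex \<Rightarrow> complex)) \<Rightarrow> real" where
  "H2_opnorm T = Sup {h2norm (T f) | f. f \<in> H2 \<and> h2norm f \<le> 1}"

definition H2_rank_le :: "((complex \<Rightarrow> complex) \<Rightarrow> (complex \<Rightarrow> complex)) \<Rightarrow> nat \<Rightarrow> bool" where
  "H2_rank_le F n \<longleftrightarrow> (\<exists>g :: nat \<Rightarrow> complex \<Rightarrow> complex. (\<forall>i<n. g i \<in> H2) \<and>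
     (\<forall>f\<in>H2. \<exists>c :: nat \<Rightarrow> complex. \<forall>z\<in>ball 0 1. F f z = (\<Sum>i<n. c i * g i z)))"

text \<open>Singular numbers s_n(T), n = 0,1,2,..., defined as approximation numbers
  s_n(T) = inf { ||T - F|| : rank F \<le> n } (on a Hilbert space these coincide with
  the eigenvalues of |T| in decreasing order, with multiplicity).\<close>
definition sing_num :: "((complex \<Rightarrow> complex) \<Rightarrow> (complex \<Rightarrow> complex)) \<Rightarrow> nat \<Rightarrow> real" where
  "sing_num T n = Inf {H2_opnorm (\<lambda>f z. T f z - F f z) | F.
                        H2_bounded_op F \<and> H2_rank_le F n}"

definition H2_compact_op :: "((complex \<Rightarrow> complex) \<Rightarrow> (complex \<Rightarrow> complex)) \<Rightarrow> bool" where
  "H2_compact_op T \<longleftrightarrow> H2_bounded_op T \<and>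
     (\<forall>f :: nat \<Rightarrow> complex \<Rightarrow> complex. (\<forall>k. f k \<in> H2) \<and> (\<exists>M. \<forall>k. h2norm (f k) \<le> M) \<longrightarrow>
        (\<exists>r :: nat \<Rightarrow> nat. strict_mono r \<and> (\<forall>e>0. \<exists>N. \<forall>m\<ge>N. \<forall>n\<ge>N.
            h2norm (\<lambda>z. T (f (r m)) z - T (f (r n)) z) < e)))"

definition schatten :: "real \<Rightarrow> ((complex \<Rightarrow> complex) \<Rightarrow> (complex \<Rightarrow> complex)) \<Rightarrow> bool" where
  "schatten p T \<longleftrightarrow> H2_compact_op T \<and> summable (\<lambda>n. sing_num T n powr p)"

definition wcomp :: "(complex \<Rightarrow> complex) \<Rightarrow> (complex \<Rightarrow> complex) \<Rightarrow> (complex \<Rightarrow> complex) \<Rightarrow> (complex \<Rightarrow> complex)" where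
  "wcomp w \<phi> f = (\<lambda>z. w z * f (\<phi> z))"

definition unimodular_set :: "(complex \<Rightarrow> complex) \<Rightarrow> real set" where
  "unimodular_set \<phi> = {t \<in> {0..2*pi}. \<exists>L. ((\<lambda>r::real. \<phi> (complex_of_real r * cis t)) \<longlongrightarrow> L) (at_left 1) \<and> norm L = 1}"

end

theory Submission
  imports Defs "HOL-Complex_Analysis.Complex_Analysis" "HOL-Real_Asymp.Real_Asymp"
begin

text \<open>
  If \<open>F\<close> has rank at most \<open>n\<close>, then \<open>\<Sum>j<N. \<parallel>T z\<^sup>j\<parallel>\<^sup>2 \<le> n \<parallel>T\<parallel>\<^sup>2 + N \<parallel>T - F\<parallel>\<^sup>2\<close>. So it suffices to find
  \<open>\<phi>\<close> for which \<open>\<parallel>w \<phi>\<^sup>N\<parallel>\<close> decays more slowly than every power of \<open>N\<close>, whatever \<open>w \<noteq> 0\<close> is.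
  The symbol \<open>\<phi> = exp (-g)\<close> is explicit: \<open>Re g\<close> is continuous on the closed disc, on the circle it
  vanishes only at \<open>1\<close>, and it is at most \<open>2\<^bsup>-K\<^sup>2\<^esup>\<close> on an arc around \<open>1\<close> of length comparable to
  \<open>1/K\<close>. A function \<open>w \<noteq> 0\<close> in \<open>H\<^sup>2\<close> cannot be too small on such an arc: let \<open>H\<close> be an outer
  function with \<open>\<bar>H\<bar> = 1\<close> off the arc, \<open>\<bar>H\<bar> \<le> e\<^bsup>LK\<^esup>\<close> on it, and \<open>\<bar>H(z\<^sub>0)\<bar>\<close> bounded below by a
  large constant independent of \<open>K\<close>; estimating \<open>(w H)(z\<^sub>0)\<close> by the mean of \<open>\<bar>w H\<bar>\<^sup>2\<close> over circles
  yields \<open>\<parallel>w \<phi>\<^sup>N\<parallel>\<^sup>2 \<ge> c e\<^bsup>-2LK\<^esup>\<close> for \<open>N = 2\<^bsup>K\<^sup>2\<^esup>\<close>, while any power of \<open>N\<close> is exponential in \<open>K\<^sup>2\<close>.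
\<close>

section \<open>Approximation numbers\<close>

text \<open>Induction on \<open>n\<close>: all vectors are projected onto the orthogonal complement
  of \<open>g n\<close>. The removed components contribute at most \<open>B\<close>, the hypothesis
  survives, and the approximation error does not grow, since the projection is a linear contraction
  that kills \<open>g n\<close>.\<close>

lemma trace_le_rank_plus_approximation_error:
  fixes x :: "'j \<Rightarrow> 'i \<Rightarrow> complex" and g :: "nat \<Rightarrow> 'i \<Rightarrow> complex"
  assumes I: "finite I" and B: "0 \<le> B"
    and bnd: "\<And>d. (\<Sum>i\<in>I. (norm (\<Sum>j\<in>J. d j * x j i))\<^sup>2) \<le> B * (\<Sum>j\<in>J. (norm (d j))\<^sup>2)"
  shows "(\<Sum>j\<in>J. \<Sum>i\<in>I. (norm (x j i))\<^sup>2) \<le>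
           real n * B + (\<Sum>j\<in>J. \<Sum>i\<in>I. (norm (x j i - (\<Sum>l<n. c j l * g l i)))\<^sup>2)"
  using bnd
proof (induction n arbitrary: x g)
  case 0
  then show ?case by simp
next
  case (Suc n)
  define v where "v = g n"
  define nv where "nv = (\<Sum>i\<in>I. (norm (v i))\<^sup>2)"
  have nv0: "0 \<le> nv" by (simp add: nv_def sum_nonneg)
  show ?case
  proof (cases "nv = 0")
    case True
    then have "v i = 0" if "i \<in> I" for i
      using that I by (simp add: nv_def sum_nonneg_eq_0_iff)
    then have "(\<Sum>j\<in>J. \<Sum>i\<in>I. (norm (x j i - (\<Sum>l<Suc n. c j l * g l i)))\<^sup>2) =
       (\<Sum>j\<in>J. \<Sum>i\<in>I. (norm (x j i - (\<Sum>l<n. c j l * g l i)))\<^sup>2)"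
      by (intro sum.cong) (auto simp: v_def)
    moreover have "real n * B \<le> real (Suc n) * B" using B by (simp add: algebra_simps)
    ultimately show ?thesis using Suc.IH[OF Suc.prems, of g] by linarith
  next
    case False
    with nv0 have nvp: "0 < nv" by simp
    \<comment> \<open>\<open>ip\<close> is the inner product with \<open>v\<close>, and
      \<open>pr\<close> the orthogonal projection along \<open>v\<close>; \<open>pr_norm\<close>
      below is Pythagoras.\<close>
    define ip where "ip y = (\<Sum>i\<in>I. y i * cnj (v i))" for y
    define pr where "pr y i = y i - ip y / of_real nv * v i" for y i
    have vv: "(\<Sum>i\<in>I. v i * cnj (v i)) = of_real nv"
      by (simp add: nv_def complex_norm_square[symmetric])
    have ip_sum: "ip (\<lambda>i. \<Sum>l\<in>L. d l * y l i) = (\<Sum>l\<in>L. d l * ip (y l))" for L :: "'b set" and d y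
      unfolding ip_def sum_distrib_left sum_distrib_right
      by (subst sum.swap) (simp add: mult_ac)
    have ip_diff: "ip (\<lambda>i. y i - z i) = ip y - ip z" for y z
      by (simp add: ip_def algebra_simps sum_subtractf)
    have pr_norm: "(\<Sum>i\<in>I. (norm (y i))\<^sup>2) = (\<Sum>i\<in>I. (norm (pr y i))\<^sup>2) + (norm (ip y))\<^sup>2 / nv" for y
    proof -
      define a where "a = ip y / of_real nv"
      have cip: "(\<Sum>i\<in>I. v i * cnj (y i)) = cnj (ip y)"
        by (simp add: ip_def mult.commute)
      have "of_real (\<Sum>i\<in>I. (norm (pr y i))\<^sup>2) = (\<Sum>i\<in>I. (y i - a * v i) * cnj (y i - a * v i))"
        by (simp only: of_real_sum complex_norm_square pr_def a_def)
      also have "\<dots> = (\<Sum>i\<in>I. y i * cnj (y i)) - cnj a * (\<Sum>i\<in>I. y i * cnj (v i))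
          - a * (\<Sum>i\<in>I. v i * cnj (y i)) + a * cnj a * (\<Sum>i\<in>I. v i * cnj (v i))"
        by (simp add: algebra_simps sum.distrib sum_subtractf sum_distrib_left)
      also have "\<dots> = of_real (\<Sum>i\<in>I. (norm (y i))\<^sup>2) - cnj a * ip y - a * cnj (ip y) + a * cnj a * of_real nv"
        by (simp only: vv cip ip_def of_real_sum complex_norm_square)
      also have "\<dots> = of_real (\<Sum>i\<in>I. (norm (y i))\<^sup>2) - ip y * cnj (ip y) / of_real nv"
        using nvp by (simp add: a_def field_simps)
      also have "\<dots> = of_real ((\<Sum>i\<in>I. (norm (y i))\<^sup>2) - (norm (ip y))\<^sup>2 / nv)"
        by (simp add: complex_norm_square[symmetric])
      finally show ?thesis unfolding of_real_eq_iff by simp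
    qed
    have pr_le: "(\<Sum>i\<in>I. (norm (pr y i))\<^sup>2) \<le> (\<Sum>i\<in>I. (norm (y i))\<^sup>2)" for y
      using pr_norm[of y] nvp by simp
    have ip_le: "(norm (ip y))\<^sup>2 \<le> nv * (\<Sum>i\<in>I. (norm (y i))\<^sup>2)" for y
    proof -
      have "0 \<le> (\<Sum>i\<in>I. (norm (pr y i))\<^sup>2)" by (simp add: sum_nonneg)
      with pr_norm[of y] have "(norm (ip y))\<^sup>2 / nv \<le> (\<Sum>i\<in>I. (norm (y i))\<^sup>2)" by linarith
      then show ?thesis using nvp by (simp add: field_simps)
    qed
    have pr_sum: "pr (\<lambda>i. \<Sum>l\<in>L. d l * y l i) i = (\<Sum>l\<in>L. d l * pr (y l) i)" for L :: "'b set" and d y i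
      unfolding pr_def ip_sum
      by (simp add: algebra_simps sum_subtractf sum_distrib_left sum_distrib_right sum_divide_distrib)
    have pr_diff: "pr (\<lambda>i. y i - z i) i = pr y i - pr z i" for y z i
      by (simp add: pr_def ip_diff algebra_simps diff_divide_distrib)
    have pr_v: "pr v i = 0" for i
      using nvp by (simp add: pr_def ip_def vv)
    have S: "(\<Sum>j\<in>J. (norm (ip (x j)))\<^sup>2) \<le> B * nv"
    proof -
      define S where "S = (\<Sum>j\<in>J. (norm (ip (x j)))\<^sup>2)"
      \<comment> \<open>This choice of coefficients bounds the adjoint of
        \<open>d \<mapsto> \<Sum>j. d j * x j\<close> at \<open>v\<close>: the combination has inner
        product \<open>S\<close> with \<open>v\<close>, so Cauchy-Schwarz gives
        \<open>S * S \<le> B * nv * S\<close>.\<close>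
      define d where "d j = cnj (ip (x j))" for j
      have S0: "0 \<le> S" by (simp add: S_def sum_nonneg)
      have "ip (\<lambda>i. \<Sum>j\<in>J. d j * x j i) = of_real S"
        unfolding ip_sum S_def d_def of_real_sum complex_norm_square by (simp add: mult.commute)
      then have "S\<^sup>2 \<le> nv * (\<Sum>i\<in>I. (norm (\<Sum>j\<in>J. d j * x j i))\<^sup>2)"
        using ip_le[of "\<lambda>i. \<Sum>j\<in>J. d j * x j i"] by simp
      also have "\<dots> \<le> nv * (B * (\<Sum>j\<in>J. (norm (d j))\<^sup>2))"
        using nvp Suc.prems by (intro mult_left_mono) auto
      also have "\<dots> = (B * nv) * S" by (simp add: S_def d_def)
      finally have "S * S \<le> (B * nv) * S" by (simp add: power2_eq_square)
      then have "S \<le> B * nv" using S0 B nvp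
        by (cases "S = 0") auto
      then show ?thesis by (simp add: S_def)
    qed
    have bnd': "(\<Sum>i\<in>I. (norm (\<Sum>j\<in>J. d j * pr (x j) i))\<^sup>2) \<le> B * (\<Sum>j\<in>J. (norm (d j))\<^sup>2)" for d
      using order_trans[OF pr_le Suc.prems[of d]] by (simp add: pr_sum)
    have "(\<Sum>j\<in>J. \<Sum>i\<in>I. (norm (x j i))\<^sup>2) =
        (\<Sum>j\<in>J. (\<Sum>i\<in>I. (norm (pr (x j) i))\<^sup>2) + (norm (ip (x j)))\<^sup>2 / nv)"
      by (rule sum.cong[OF refl pr_norm])
    also have "\<dots> = (\<Sum>j\<in>J. \<Sum>i\<in>I. (norm (pr (x j) i))\<^sup>2) + (\<Sum>j\<in>J. (norm (ip (x j)))\<^sup>2) / nv"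
      by (simp add: sum.distrib sum_divide_distrib)
    also have "(\<Sum>j\<in>J. (norm (ip (x j)))\<^sup>2) / nv \<le> B" using S nvp by (simp add: field_simps)
    also have "(\<Sum>j\<in>J. \<Sum>i\<in>I. (norm (pr (x j) i))\<^sup>2) \<le>
        real n * B + (\<Sum>j\<in>J. \<Sum>i\<in>I. (norm (pr (x j) i - (\<Sum>l<n. c j l * pr (g l) i)))\<^sup>2)"
      by (rule Suc.IH[OF bnd'])
    also have "(\<Sum>j\<in>J. \<Sum>i\<in>I. (norm (pr (x j) i - (\<Sum>l<n. c j l * pr (g l) i)))\<^sup>2) \<le>
       (\<Sum>j\<in>J. \<Sum>i\<in>I. (norm (x j i - (\<Sum>l<Suc n. c j l * g l i)))\<^sup>2)"
    proof (rule sum_mono)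
      fix j
      have "pr (x j) i - (\<Sum>l<n. c j l * pr (g l) i) =
          pr (\<lambda>i. x j i - (\<Sum>l<Suc n. c j l * g l i)) i" for i
        unfolding pr_diff pr_sum using pr_v by (simp add: v_def)
      then show "(\<Sum>i\<in>I. (norm (pr (x j) i - (\<Sum>l<n. c j l * pr (g l) i)))\<^sup>2)
         \<le> (\<Sum>i\<in>I. (norm (x j i - (\<Sum>l<Suc n. c j l * g l i)))\<^sup>2)"
        using pr_le by simp
    qed
    finally show ?thesis by (simp add: algebra_simps)
  qed
qed

section \<open>Taylor coefficients and the norm of the Hardy space\<close>

text \<open>Linearity and finite rank of operators are imposed only at points of the disc; this
  lemma carries such pointwise identities over to coefficients.\<close>

lemma taylor_coef_cong:
  assumes "\<And>z. z \<in> ball 0 1 \<Longrightarrow> f z = g z"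
  shows "taylor_coef f n = taylor_coef g n"
proof -
  have "eventually (\<lambda>z. f z = g z) (nhds 0)"
    by (rule eventually_mono[OF eventually_nhds_in_open[of "ball 0 1"]]) (use assms in auto)
  then have "(deriv ^^ n) f 0 = (deriv ^^ n) g 0"
    by (rule higher_deriv_cong_ev) simp
  then show ?thesis by (simp add: taylor_coef_def)
qed

lemma taylor_coef_diff:
  assumes "f holomorphic_on ball 0 1" "g holomorphic_on ball 0 1"
  shows "taylor_coef (\<lambda>z. f z - g z) n = taylor_coef f n - taylor_coef g n"
  unfolding taylor_coef_def
  by (subst higher_deriv_diff[OF assms]) (auto simp: diff_divide_distrib)

lemma taylor_coef_sum:
  assumes "\<And>l. l < (n::nat) \<Longrightarrow> g l holomorphic_on ball 0 1"
  shows "taylor_coef (\<lambda>z. \<Sum>l<n. c l * g l z) i = (\<Sum>l<n. c l * taylor_coef (g l) i)"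
  using assms
proof (induction n)
  case 0
  then show ?case by (simp add: taylor_coef_def)
next
  case (Suc n)
  have h: "(\<lambda>z. \<Sum>l<n. c l * g l z) holomorphic_on ball 0 1"
    "(\<lambda>z. c n * g n z) holomorphic_on ball 0 1"
    using Suc.prems by (auto intro!: holomorphic_intros)
  have "taylor_coef (\<lambda>z. \<Sum>l<Suc n. c l * g l z) i =
      taylor_coef (\<lambda>z. \<Sum>l<n. c l * g l z) i + taylor_coef (\<lambda>z. c n * g n z) i"
    unfolding taylor_coef_def sum.lessThan_Suc
    by (subst higher_deriv_add[OF h]) (auto simp: add_divide_distrib)
  also have "taylor_coef (\<lambda>z. c n * g n z) i = c n * taylor_coef (g n) i"
    unfolding taylor_coef_def
    by (subst higher_deriv_cmult[of _ "ball 0 1"]) (use Suc.prems in auto)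
  finally show ?case using Suc by simp
qed

lemma taylor_coef_power: "taylor_coef (\<lambda>z. z ^ j) i = (if i = j then 1 else 0)"
proof -
  have "(deriv ^^ i) (\<lambda>w::complex. w ^ j) 0 = pochhammer (of_nat (Suc j - i)) i * 0 ^ (j - i)"
    using higher_deriv_power[of i 0 j 0] by simp
  then show ?thesis
    by (cases i j rule: linorder_cases)
       (auto simp: taylor_coef_def pochhammer_0_left pochhammer_fact[symmetric])
qed

lemma taylor_coef_polynomial:
  "taylor_coef (\<lambda>z. \<Sum>j<N. d j * z ^ j) i = (if i < N then d i else 0)"
  by (subst taylor_coef_sum) (auto intro!: holomorphic_intros simp: taylor_coef_power if_distrib cong: if_cong)

lemma polynomial_H2: "(\<lambda>z. \<Sum>j<N. d j * z ^ j) \<in> H2"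
  and h2norm_polynomial: "(h2norm (\<lambda>z. \<Sum>j<N. d j * z ^ j))\<^sup>2 = (\<Sum>j<N. (norm (d j))\<^sup>2)"
proof -
  have "(\<lambda>i. (norm (taylor_coef (\<lambda>z. \<Sum>j<N. d j * z ^ j) i))\<^sup>2) sums
      (\<Sum>i<N. (norm (taylor_coef (\<lambda>z. \<Sum>j<N. d j * z ^ j) i))\<^sup>2)"
    by (rule sums_finite) (auto simp: taylor_coef_polynomial)
  then have s: "(\<lambda>i. (norm (taylor_coef (\<lambda>z. \<Sum>j<N. d j * z ^ j) i))\<^sup>2) sums (\<Sum>j<N. (norm (d j))\<^sup>2)"
    by (simp add: taylor_coef_polynomial)
  show "(\<lambda>z. \<Sum>j<N. d j * z ^ j) \<in> H2"
    using sums_summable[OF s] by (auto simp: H2_def intro!: holomorphic_intros)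
  show "(h2norm (\<lambda>z. \<Sum>j<N. d j * z ^ j))\<^sup>2 = (\<Sum>j<N. (norm (d j))\<^sup>2)"
    by (simp add: h2norm_def sums_unique[OF s, symmetric] sum_nonneg)
qed

lemma power_H2: "(\<lambda>z. z ^ j) \<in> H2" and h2norm_power: "h2norm (\<lambda>z. z ^ j) = 1"
proof -
  have s: "(\<lambda>i. (norm (taylor_coef (\<lambda>z. z ^ j) i))\<^sup>2) sums 1"
    using sums_single[of j "\<lambda>_. 1::real"] by (simp add: taylor_coef_power if_distrib[of "\<lambda>x. (norm x)\<^sup>2"] cong: if_cong)
  show "(\<lambda>z. z ^ j) \<in> H2"
    using sums_summable[OF s] by (auto simp: H2_def intro!: holomorphic_intros)
  show "h2norm (\<lambda>z. z ^ j) = 1"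
    using sums_unique[OF s] by (simp add: h2norm_def)
qed

lemma h2norm_nonneg: "f \<in> H2 \<Longrightarrow> 0 \<le> h2norm f"
  by (simp add: h2norm_def H2_def suminf_nonneg)

lemma h2norm_squared: "f \<in> H2 \<Longrightarrow> (h2norm f)\<^sup>2 = (\<Sum>n. (norm (taylor_coef f n))\<^sup>2)"
  by (simp add: h2norm_def H2_def suminf_nonneg)

lemma sum_taylor_coef_le_h2norm:
  "f \<in> H2 \<Longrightarrow> (\<Sum>i<M. (norm (taylor_coef f i))\<^sup>2) \<le> (h2norm f)\<^sup>2"
  unfolding h2norm_squared by (rule sum_le_suminf) (auto simp: H2_def)

text \<open>The parallelogram-type bound with factor 2 replaces the triangle inequality; it only has
  to show that the supremum in \<open>H2_opnorm\<close> of a difference is finite.\<close>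

lemma H2_diff: 
  assumes f: "f \<in> H2" and g: "g \<in> H2"
  shows "(\<lambda>z. f z - g z) \<in> H2"
    and h2norm_diff_squared_le: "(h2norm (\<lambda>z. f z - g z))\<^sup>2 \<le> 2 * (h2norm f)\<^sup>2 + 2 * (h2norm g)\<^sup>2"
proof -
  have h: "f holomorphic_on ball 0 1" "g holomorphic_on ball 0 1"
    and s: "summable (\<lambda>n. (norm (taylor_coef f n))\<^sup>2)" "summable (\<lambda>n. (norm (taylor_coef g n))\<^sup>2)"
    using f g by (auto simp: H2_def)
  have le: "(norm (taylor_coef (\<lambda>z. f z - g z) n))\<^sup>2 \<le>
      2 * (norm (taylor_coef f n))\<^sup>2 + 2 * (norm (taylor_coef g n))\<^sup>2" for n
  proof -
    define a b where "a = norm (taylor_coef f n)" and "b = norm (taylor_coef g n)"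
    have "(norm (taylor_coef (\<lambda>z. f z - g z) n))\<^sup>2 \<le> (a + b)\<^sup>2"
      unfolding taylor_coef_diff[OF h] a_def b_def
      by (intro power_mono norm_triangle_ineq4) auto
    also have "\<dots> \<le> 2 * a\<^sup>2 + 2 * b\<^sup>2"
      using zero_le_power2[of "a - b"] by (simp add: power2_eq_square algebra_simps)
    finally show ?thesis by (simp add: a_def b_def)
  qed
  have s2: "summable (\<lambda>n. 2 * (norm (taylor_coef f n))\<^sup>2 + 2 * (norm (taylor_coef g n))\<^sup>2)"
    by (intro summable_add summable_mult s)
  have s3: "summable (\<lambda>n. (norm (taylor_coef (\<lambda>z. f z - g z) n))\<^sup>2)"
    by (rule summable_comparison_test'[OF s2, of 0]) (use le in auto)
  show H: "(\<lambda>z. f z - g z) \<in> H2"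
    using s3 h by (auto simp: H2_def intro!: holomorphic_intros)
  have "(h2norm (\<lambda>z. f z - g z))\<^sup>2 \<le> (\<Sum>n. 2 * (norm (taylor_coef f n))\<^sup>2 + 2 * (norm (taylor_coef g n))\<^sup>2)"
    unfolding h2norm_squared[OF H] by (rule suminf_le[OF le s3 s2])
  also have "\<dots> = 2 * (h2norm f)\<^sup>2 + 2 * (h2norm g)\<^sup>2"
    unfolding h2norm_squared[OF f] h2norm_squared[OF g]
    using s by (simp add: suminf_add[symmetric] suminf_mult summable_mult)
  finally show "(h2norm (\<lambda>z. f z - g z))\<^sup>2 \<le> 2 * (h2norm f)\<^sup>2 + 2 * (h2norm g)\<^sup>2" .
qed

section \<open>Bounded operators and their approximation by finite rank\<close>

lemma H2_linear_add:
  "H2_linear T \<Longrightarrow> f \<in> H2 \<Longrightarrow> g \<in> H2 \<Longrightarrow> z \<in> ball 0 1 \<Longrightarrow> T (\<lambda>x. f x + g x) z = T f z + T g z"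
  by (simp add: H2_linear_def)

lemma H2_linear_cmult:
  "H2_linear T \<Longrightarrow> f \<in> H2 \<Longrightarrow> z \<in> ball 0 1 \<Longrightarrow> T (\<lambda>x. c * f x) z = c * T f z"
  by (simp add: H2_linear_def)

lemma H2_linear_polynomial:
  assumes "H2_linear T" "z \<in> ball 0 1"
  shows "T (\<lambda>z. \<Sum>j<N. d j * z ^ j) z = (\<Sum>j<N. d j * T (\<lambda>z. z ^ j) z)"
proof (induction N)
  case 0
  \<comment> \<open>The empty sum is the zero function; homogeneity with scalar \<open>0\<close>
    shows that \<open>T\<close> maps it to \<open>0\<close>.\<close>
  have "T (\<lambda>x. 0 * (x ^ 0)) z = 0 * T (\<lambda>x. x ^ 0) z"
    by (rule H2_linear_cmult[OF assms(1) power_H2 assms(2)])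
  then show ?case by simp
next
  case (Suc N)
  have "(\<lambda>z. d N * z ^ N) \<in> H2"
  proof -
    have "(\<lambda>z. \<Sum>j<Suc N. (if j = N then d N else 0) * z ^ j) \<in> H2" by (rule polynomial_H2)
    moreover have "(\<lambda>z. \<Sum>j<Suc N. (if j = N then d N else 0) * z ^ j) = (\<lambda>z. d N * z ^ N)"
      by (auto simp: fun_eq_iff if_distrib[of "\<lambda>x. x * _"] cong: if_cong)
    ultimately show ?thesis by simp
  qed
  then have "T (\<lambda>x. (\<Sum>j<N. d j * x ^ j) + d N * x ^ N) z =
      T (\<lambda>x. \<Sum>j<N. d j * x ^ j) z + T (\<lambda>x. d N * x ^ N) z"
    by (rule H2_linear_add[OF assms(1) polynomial_H2 _ assms(2)])
  moreover have "T (\<lambda>x. d N * x ^ N) z = d N * T (\<lambda>x. x ^ N) z"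
    by (rule H2_linear_cmult[OF assms(1) power_H2 assms(2)])
  ultimately show ?case using Suc by simp
qed

lemma H2_bounded_op_H2: "H2_bounded_op T \<Longrightarrow> f \<in> H2 \<Longrightarrow> T f \<in> H2"
  by (simp add: H2_bounded_op_def)

lemma H2_bounded_op_pos_bound:
  assumes "H2_bounded_op T"
  obtains C where "0 < C" "\<And>f. f \<in> H2 \<Longrightarrow> h2norm (T f) \<le> C * h2norm f"
proof -
  from assms obtain C where C: "\<And>f. f \<in> H2 \<Longrightarrow> h2norm (T f) \<le> C * h2norm f"
    by (auto simp: H2_bounded_op_def)
  have "h2norm (T f) \<le> (\<bar>C\<bar> + 1) * h2norm f" if "f \<in> H2" for f
    by (rule order_trans[OF C[OF that]]) (use h2norm_nonneg[OF that] in \<open>auto intro!: mult_right_mono\<close>)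
  then show ?thesis using that[of "\<bar>C\<bar> + 1"] by simp
qed

text \<open>\<open>H2_opnorm\<close> is a supremum of reals, informative only for sets bounded
  above; boundedness of \<open>T\<close> and \<open>F\<close> supplies this.\<close>

lemma h2norm_le_opnorm_diff:
  assumes T: "H2_bounded_op T" and F: "H2_bounded_op F" and f: "f \<in> H2" "h2norm f \<le> 1"
  shows "h2norm (\<lambda>z. T f z - F f z) \<le> H2_opnorm (\<lambda>f z. T f z - F f z)"
  unfolding H2_opnorm_def
proof (rule cSup_upper)
  obtain C where C: "0 < C" "\<And>f. f \<in> H2 \<Longrightarrow> h2norm (T f) \<le> C * h2norm f"
    using H2_bounded_op_pos_bound[OF T] by blast
  obtain D where D: "0 < D" "\<And>f. f \<in> H2 \<Longrightarrow> h2norm (F f) \<le> D * h2norm f"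
    using H2_bounded_op_pos_bound[OF F] by blast
  have "h2norm (\<lambda>z. T g z - F g z) \<le> sqrt (2 * C\<^sup>2 + 2 * D\<^sup>2)" if g: "g \<in> H2" "h2norm g \<le> 1" for g
  proof (rule real_le_rsqrt)
    have "h2norm (T g) \<le> C" "h2norm (F g) \<le> D"
      using C(2)[OF g(1)] D(2)[OF g(1)] C(1) D(1) g
      by (auto elim!: order_trans simp: mult_left_le)
    moreover have "0 \<le> h2norm (T g)" "0 \<le> h2norm (F g)"
      using H2_bounded_op_H2[OF T g(1)] H2_bounded_op_H2[OF F g(1)] by (auto intro: h2norm_nonneg)
    ultimately have "(h2norm (T g))\<^sup>2 \<le> C\<^sup>2" "(h2norm (F g))\<^sup>2 \<le> D\<^sup>2" by (auto intro: power_mono)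
    then show "(h2norm (\<lambda>z. T g z - F g z))\<^sup>2 \<le> 2 * C\<^sup>2 + 2 * D\<^sup>2"
      using h2norm_diff_squared_le[OF H2_bounded_op_H2[OF T g(1)] H2_bounded_op_H2[OF F g(1)]] by linarith
  qed
  then show "bdd_above {h2norm (\<lambda>z. T f z - F f z) |f. f \<in> H2 \<and> h2norm f \<le> 1}"
    by (intro bdd_aboveI) blast
qed (use f in blast)

text \<open>The trace inequality is applied to the first \<open>M\<close> Taylor coefficients, so that no
  projection in an infinite-dimensional space is needed, and then \<open>M \<rightarrow> \<infinity>\<close>.\<close>
lemma sum_h2norm_powers_le:
  assumes T: "H2_bounded_op T" and C: "0 \<le> C" "\<And>f. f \<in> H2 \<Longrightarrow> h2norm (T f) \<le> C * h2norm f"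
    and F: "H2_bounded_op F" and rank: "H2_rank_le F n"
  shows "(\<Sum>j<N. (h2norm (T (\<lambda>z. z ^ j)))\<^sup>2) \<le>
    real n * C\<^sup>2 + real N * (H2_opnorm (\<lambda>f z. T f z - F f z))\<^sup>2"
proof -
  from rank obtain g :: "nat \<Rightarrow> complex \<Rightarrow> complex"
    where g: "\<And>i. i < n \<Longrightarrow> g i \<in> H2"
      and F': "\<And>f. f \<in> H2 \<Longrightarrow> \<exists>c. \<forall>z\<in>ball 0 1. F f z = (\<Sum>i<n. c i * g i z)"
    unfolding H2_rank_le_def by blast
  \<comment> \<open>The coefficients in \<open>H2_rank_le\<close> may vary with the argument, so
    they are fixed once for each monomial.\<close>
  have "\<forall>j. \<exists>c. \<forall>z\<in>ball 0 1. F (\<lambda>z. z ^ j) z = (\<Sum>i<n. c i * g i z)"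
    using F' power_H2 by blast
  then obtain c where c: "\<And>j z. z \<in> ball 0 1 \<Longrightarrow> F (\<lambda>z. z ^ j) z = (\<Sum>i<n. c j i * g i z)"
    by metis
  have TH: "T (\<lambda>z. z ^ j) \<in> H2" and FH: "F (\<lambda>z. z ^ j) \<in> H2" for j
    using T F power_H2 by (auto simp: H2_bounded_op_def)
  have hol: "f holomorphic_on ball 0 1" if "f \<in> H2" for f using that by (simp add: H2_def)
  have M: "(\<Sum>j<N. \<Sum>i<M. (norm (taylor_coef (T (\<lambda>z. z ^ j)) i))\<^sup>2) \<le>
    real n * C\<^sup>2 + real N * (H2_opnorm (\<lambda>f z. T f z - F f z))\<^sup>2" for M
  proof -
    \<comment> \<open>The vectors are the truncated coefficient sequences of the images of the
      monomials; orthonormality of the monomials gives the bound with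
      \<open>B = C\<^sup>2\<close>.\<close>
    have "(\<Sum>j<N. \<Sum>i<M. (norm (taylor_coef (T (\<lambda>z. z ^ j)) i))\<^sup>2) \<le>
      real n * C\<^sup>2 + (\<Sum>j<N. \<Sum>i<M. (norm (taylor_coef (T (\<lambda>z. z ^ j)) i -
         (\<Sum>l<n. c j l * taylor_coef (g l) i)))\<^sup>2)"
    proof (rule trace_le_rank_plus_approximation_error)
      fix d :: "nat \<Rightarrow> complex"
      let ?p = "\<lambda>z. \<Sum>j<N. d j * z ^ j"
      have "(\<Sum>j<N. d j * taylor_coef (T (\<lambda>z. z ^ j)) i) = taylor_coef (T ?p) i" for i
      proof -
        have "taylor_coef (T ?p) i = taylor_coef (\<lambda>z. \<Sum>j<N. d j * T (\<lambda>z. z ^ j) z) i"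
          by (rule taylor_coef_cong, rule H2_linear_polynomial) (use T in \<open>auto simp: H2_bounded_op_def\<close>)
        also have "\<dots> = (\<Sum>j<N. d j * taylor_coef (T (\<lambda>z. z ^ j)) i)"
          by (rule taylor_coef_sum) (use TH hol in blast)
        finally show ?thesis by simp
      qed
      then have "(\<Sum>i<M. (norm (\<Sum>j<N. d j * taylor_coef (T (\<lambda>z. z ^ j)) i))\<^sup>2) \<le> (h2norm (T ?p))\<^sup>2"
        using sum_taylor_coef_le_h2norm[OF H2_bounded_op_H2[OF T polynomial_H2]] by simp
      also have "\<dots> \<le> (C * h2norm ?p)\<^sup>2"
        by (intro power_mono C polynomial_H2 h2norm_nonneg H2_bounded_op_H2[OF T])
      also have "\<dots> = C\<^sup>2 * (\<Sum>j<N. (norm (d j))\<^sup>2)"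
        by (simp add: power_mult_distrib h2norm_polynomial)
      finally show "(\<Sum>i<M. (norm (\<Sum>j<N. d j * taylor_coef (T (\<lambda>z. z ^ j)) i))\<^sup>2) \<le>
        C\<^sup>2 * (\<Sum>j<N. (norm (d j))\<^sup>2)" .
    qed auto
    also have "(\<Sum>j<N. \<Sum>i<M. (norm (taylor_coef (T (\<lambda>z. z ^ j)) i -
         (\<Sum>l<n. c j l * taylor_coef (g l) i)))\<^sup>2) \<le> (\<Sum>j<N. (H2_opnorm (\<lambda>f z. T f z - F f z))\<^sup>2)"
    proof (rule sum_mono)
      fix j
      let ?D = "\<lambda>z. T (\<lambda>z. z ^ j) z - F (\<lambda>z. z ^ j) z"
      have D: "?D \<in> H2" by (rule H2_diff[OF TH FH])
      have "(\<Sum>l<n. c j l * taylor_coef (g l) i) = taylor_coef (F (\<lambda>z. z ^ j)) i" for i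
      proof -
        have "taylor_coef (F (\<lambda>z. z ^ j)) i = taylor_coef (\<lambda>z. \<Sum>l<n. c j l * g l z) i"
          by (rule taylor_coef_cong, rule c)
        also have "\<dots> = (\<Sum>l<n. c j l * taylor_coef (g l) i)"
          by (rule taylor_coef_sum) (use g hol in blast)
        finally show ?thesis by simp
      qed
      then have "(\<Sum>i<M. (norm (taylor_coef (T (\<lambda>z. z ^ j)) i -
         (\<Sum>l<n. c j l * taylor_coef (g l) i)))\<^sup>2) = (\<Sum>i<M. (norm (taylor_coef ?D i))\<^sup>2)"
        by (simp add: taylor_coef_diff[OF hol[OF TH] hol[OF FH]])
      also have "\<dots> \<le> (h2norm ?D)\<^sup>2" by (rule sum_taylor_coef_le_h2norm[OF D])
      also have "\<dots> \<le> (H2_opnorm (\<lambda>f z. T f z - F f z))\<^sup>2"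
        by (intro power_mono h2norm_le_opnorm_diff T F power_H2 h2norm_nonneg[OF D]) (simp add: h2norm_power)
      finally show "(\<Sum>i<M. (norm (taylor_coef (T (\<lambda>z. z ^ j)) i -
         (\<Sum>l<n. c j l * taylor_coef (g l) i)))\<^sup>2) \<le> (H2_opnorm (\<lambda>f z. T f z - F f z))\<^sup>2" .
    qed
    finally show ?thesis by simp
  qed
  have "(\<lambda>M. \<Sum>j<N. \<Sum>i<M. (norm (taylor_coef (T (\<lambda>z. z ^ j)) i))\<^sup>2)
      \<longlonglongrightarrow> (\<Sum>j<N. (h2norm (T (\<lambda>z. z ^ j)))\<^sup>2)"
    unfolding h2norm_squared[OF TH]
    by (intro tendsto_sum summable_LIMSEQ) (use TH in \<open>auto simp: H2_def\<close>)
  then show ?thesis by (rule LIMSEQ_le_const2) (use M in blast)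
qed

text \<open>Every competitor \<open>F\<close> of rank at most \<open>n\<close> satisfies
  \<open>N * \<beta> \<le> n * C\<^sup>2 + N * x\<^sup>2\<close> with \<open>x\<close> the norm of
  \<open>T - F\<close>; solving for \<open>x\<close> gives the bound. A negative radicand is
  harmless, as \<open>sqrt\<close> is then negative.\<close>

lemma sqrt_le_sing_num:
  assumes T: "H2_bounded_op T" and C: "0 \<le> C" "\<And>f. f \<in> H2 \<Longrightarrow> h2norm (T f) \<le> C * h2norm f"
    and N: "0 < N" and \<beta>: "\<And>j. j < N \<Longrightarrow> \<beta> \<le> (h2norm (T (\<lambda>z. z ^ j)))\<^sup>2"
  shows "sqrt (\<beta> - real n * C\<^sup>2 / real N) \<le> sing_num T n"
  unfolding sing_num_def
proof (rule cInf_greatest)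
  \<comment> \<open>The zero operator is a competitor, so the infimum is over a nonempty
    set.\<close>
  have z: "taylor_coef (\<lambda>z. 0) i = 0" for i by (simp add: taylor_coef_def)
  then have "H2_bounded_op (\<lambda>f z. 0)"
    by (auto simp: H2_bounded_op_def H2_linear_def H2_def h2norm_def intro!: exI[of _ 0])
  moreover have "H2_rank_le (\<lambda>f z. 0) n"
    unfolding H2_rank_le_def by (rule exI[of _ "\<lambda>_ _. 0"]) (use z in \<open>auto simp: H2_def\<close>)
  ultimately show "{H2_opnorm (\<lambda>f z. T f z - F f z) |F. H2_bounded_op F \<and> H2_rank_le F n} \<noteq> {}"
    by blast
next
  fix x assume "x \<in> {H2_opnorm (\<lambda>f z. T f z - F f z) |F. H2_bounded_op F \<and> H2_rank_le F n}"
  then obtain F where F: "H2_bounded_op F" "H2_rank_le F n" and x: "x = H2_opnorm (\<lambda>f z. T f z - F f z)"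
    unfolding mem_Collect_eq by (elim exE conjE)
  have "0 \<le> h2norm (\<lambda>z. T (\<lambda>z. z ^ 0) z - F (\<lambda>z. z ^ 0) z)"
    by (rule h2norm_nonneg[OF H2_diff(1)[OF H2_bounded_op_H2[OF T power_H2] H2_bounded_op_H2[OF F(1) power_H2]]])
  also have "\<dots> \<le> x"
    unfolding x by (rule h2norm_le_opnorm_diff[OF T F(1) power_H2]) (simp only: h2norm_power order_refl)
  finally have x0: "0 \<le> x" .
  have "real N * \<beta> \<le> (\<Sum>j<N. (h2norm (T (\<lambda>z. z ^ j)))\<^sup>2)"
    using sum_mono[of "{..<N}" "\<lambda>_. \<beta>" "\<lambda>j. (h2norm (T (\<lambda>z. z ^ j)))\<^sup>2"] \<beta> by simp
  also have "\<dots> \<le> real n * C\<^sup>2 + real N * x\<^sup>2"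
    unfolding x by (rule sum_h2norm_powers_le[OF T C F])
  finally have "\<beta> - real n * C\<^sup>2 / real N \<le> x\<^sup>2" using N by (simp add: field_simps)
  then show "sqrt (\<beta> - real n * C\<^sup>2 / real N) \<le> x"
    by (rule real_le_lsqrt[OF x0])
qed

section \<open>Means over circles\<close>

text \<open>Parametrising by \<open>circlepath\<close> over the unit interval normalises the arc
  length measure and matches the form of Cauchy's integral formula.\<close>

definition circle_mean :: "real \<Rightarrow> (complex \<Rightarrow> real) \<Rightarrow> real" where
  "circle_mean r u = integral {0..1} (\<lambda>t. u (circlepath 0 r t))"

lemma has_integral_character:
  "((\<lambda>t. exp (2 * of_real pi * \<i> * of_int m * of_real t)) has_integral (if m = 0 then 1 else 0)) {0..1}"
proof (cases "m = 0")
  case True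
  then show ?thesis using has_integral_const_real[of "1::complex" 0 1] by simp
next
  case False
  define c where "c = 2 * of_real pi * \<i> * of_int m"
  have c: "c \<noteq> 0" using False by (simp add: c_def)
  have "((\<lambda>t. exp (c * of_real t)) has_integral (exp (c * of_real 1) / c - exp (c * of_real 0) / c)) {0..1}"
  proof (rule fundamental_theorem_of_calculus)
    fix t :: real
    have "((\<lambda>z. exp (c * z) / c) has_field_derivative exp (c * of_real t)) (at (of_real t))"
      using c by (auto intro!: derivative_eq_intros)
    then show "((\<lambda>t. exp (c * of_real t) / c) has_vector_derivative exp (c * of_real t)) (at t within {0..1})"
      by (rule has_vector_derivative_real_field[THEN has_vector_derivative_at_within])
  qed simp
  moreover have "exp c = 1"
    unfolding c_def by (subst exp_eq_1) (auto intro!: exI[of _ m])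
  ultimately show ?thesis using False by (simp add: c_def)
qed

text \<open>Parseval for polynomials: the squared modulus is expanded as a double sum, and only the
  diagonal survives integration of the characters.\<close>

lemma has_integral_polynomial_circle:
  "((\<lambda>t. (norm (\<Sum>k<n. a k * (circlepath 0 r t) ^ k))\<^sup>2) has_integral
     (\<Sum>k<n. (norm (a k))\<^sup>2 * r ^ (2 * k))) {0..1}"
proof -
  let ?e = "\<lambda>m t. exp (2 * of_real pi * \<i> * of_int m * of_real t)"
  have pw: "(circlepath 0 r t) ^ k * cnj ((circlepath 0 r t) ^ l) = of_real (r ^ (k + l)) * ?e (int k - int l) t" for k l t
  proof -
    have cn: "cnj (exp (2 * of_real pi * \<i> * of_real t)) = exp (- (2 * of_real pi * \<i> * of_real t))"
      by (subst exp_cnj) simp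
    have "exp (2 * of_real pi * \<i> * of_real t) ^ k * cnj (exp (2 * of_real pi * \<i> * of_real t) ^ l)
       = exp (of_nat k * (2 * of_real pi * \<i> * of_real t)) * exp (of_nat l * (- (2 * of_real pi * \<i> * of_real t)))"
      by (simp only: exp_of_nat_mult complex_cnj_power cn)
    also have "\<dots> = ?e (int k - int l) t"
      by (simp add: exp_add[symmetric] algebra_simps)
    finally show ?thesis
      by (simp add: circlepath power_mult_distrib power_add mult_ac)
  qed
  have pw2: "a k * cnj (a l) * of_real (r ^ (k + l)) * ?e (int k - int l) t =
      a k * circlepath 0 r t ^ k * (cnj (a l) * cnj (circlepath 0 r t ^ l))" for k l t
  proof -
    have "a k * circlepath 0 r t ^ k * (cnj (a l) * cnj (circlepath 0 r t ^ l)) =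
        a k * cnj (a l) * (circlepath 0 r t ^ k * cnj (circlepath 0 r t ^ l))"
      by (simp only: mult_ac)
    then show ?thesis unfolding pw by (simp only: mult.assoc)
  qed
  have "((\<lambda>t. \<Sum>k<n. \<Sum>l<n. a k * cnj (a l) * of_real (r ^ (k + l)) * ?e (int k - int l) t) has_integral
     (\<Sum>k<n. \<Sum>l<n. a k * cnj (a l) * of_real (r ^ (k + l)) * (if int k - int l = 0 then 1 else 0))) {0..1}"
    by (intro has_integral_sum has_integral_mult_right has_integral_character) auto
  also have "(\<lambda>t. \<Sum>k<n. \<Sum>l<n. a k * cnj (a l) * of_real (r ^ (k + l)) * ?e (int k - int l) t) =
     (\<lambda>t. of_real ((norm (\<Sum>k<n. a k * (circlepath 0 r t) ^ k))\<^sup>2))"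
    unfolding complex_norm_square cnj_sum sum_product complex_cnj_mult
    by (simp only: pw2)
  also have "(\<Sum>k<n. \<Sum>l<n. a k * cnj (a l) * of_real (r ^ (k + l)) * (if int k - int l = 0 then 1 else 0)) =
     of_real (\<Sum>k<n. (norm (a k))\<^sup>2 * r ^ (2 * k))"
    by (simp add: if_distrib complex_norm_square[symmetric] mult_2 power_add cong: if_cong)
  finally show ?thesis
    by (drule_tac has_integral_linear[OF _ bounded_linear_Re]) (simp add: o_def)
qed

lemma continuous_on_circlepath_compose:
  assumes "continuous_on (ball 0 1) u" "0 \<le> r" "r < 1"
  shows "continuous_on {0..1} (\<lambda>t. u (circlepath 0 r t))"
  by (rule continuous_on_compose2[OF assms(1)])
     (use assms in \<open>auto simp: circlepath norm_mult intro!: continuous_intros\<close>)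

text \<open>Parseval for the Taylor partial sums, whose weights \<open>r ^ (2 * k)\<close> are at
  most \<open>1\<close>, followed by dominated convergence.\<close>

lemma circle_mean_le_h2norm:
  assumes f: "f \<in> H2" and r: "0 \<le> r" "r < 1"
  shows "circle_mean r (\<lambda>z. (norm (f z))\<^sup>2) \<le> (h2norm f)\<^sup>2"
proof -
  have hol: "f holomorphic_on ball 0 1" using f by (simp add: H2_def)
  define S where "S n t = (\<Sum>k<n. taylor_coef f k * (circlepath 0 r t) ^ k)" for n t
  \<comment> \<open>Each coefficient is at most \<open>h2norm f\<close>, so a geometric series
    bounds all partial sums on the circle by \<open>B\<close>.\<close>
  define B where "B = h2norm f / (1 - r)"
  have nr: "norm (circlepath 0 r t) = r" for t using r by (simp add: circlepath norm_mult)
  have coef: "norm (taylor_coef f k) \<le> h2norm f" for k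
  proof (rule power2_le_imp_le[OF _ h2norm_nonneg[OF f]])
    have "(norm (taylor_coef f k))\<^sup>2 \<le> (\<Sum>i<Suc k. (norm (taylor_coef f i))\<^sup>2)"
      by (rule member_le_sum) auto
    then show "(norm (taylor_coef f k))\<^sup>2 \<le> (h2norm f)\<^sup>2"
      using sum_taylor_coef_le_h2norm[OF f] order_trans by blast
  qed
  have SB: "norm (S n t) \<le> B" for n t
  proof -
    have "norm (S n t) \<le> (\<Sum>k<n. h2norm f * r ^ k)"
      unfolding S_def using r nr
      by (intro sum_norm_le) (auto simp: norm_mult norm_power intro!: mult_right_mono coef)
    also have "\<dots> = h2norm f * (\<Sum>k<n. r ^ k)" by (simp add: sum_distrib_left)
    also have "\<dots> \<le> h2norm f * (\<Sum>k. r ^ k)"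
      using r h2norm_nonneg[OF f] by (intro mult_left_mono sum_le_suminf summable_geometric) auto
    also have "\<dots> = B" using r by (simp add: B_def suminf_geometric)
    finally show ?thesis .
  qed
  have lim: "(\<lambda>n. S n t) \<longlonglongrightarrow> f (circlepath 0 r t)" for t
  proof -
    have "circlepath 0 r t \<in> ball 0 1" using nr r by simp
    from holomorphic_power_series[OF hol this] show ?thesis
      by (simp add: sums_def S_def taylor_coef_def)
  qed
  have lim2: "(\<lambda>n. integral {0..1} (\<lambda>t. (norm (S n t))\<^sup>2)) \<longlonglongrightarrow> integral {0..1} (\<lambda>t. (norm (f (circlepath 0 r t)))\<^sup>2)"
  proof (rule dominated_convergence(2)[where h = "\<lambda>_. B\<^sup>2"])
    show "(\<lambda>t. (norm (S n t))\<^sup>2) integrable_on {0..1}" for n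
      unfolding S_def using has_integral_polynomial_circle by blast
    show "norm ((norm (S n t))\<^sup>2) \<le> B\<^sup>2" for n t using SB[of n t] by (auto intro: power_mono)
    show "(\<lambda>n. (norm (S n t))\<^sup>2) \<longlonglongrightarrow> (norm (f (circlepath 0 r t)))\<^sup>2" for t
      by (intro tendsto_intros lim)
  qed auto
  have bnd: "integral {0..1} (\<lambda>t. (norm (S n t))\<^sup>2) \<le> (h2norm f)\<^sup>2" for n
  proof -
    have "integral {0..1} (\<lambda>t. (norm (S n t))\<^sup>2) = (\<Sum>k<n. (norm (taylor_coef f k))\<^sup>2 * r ^ (2 * k))"
      unfolding S_def by (rule integral_unique[OF has_integral_polynomial_circle])
    also have "\<dots> \<le> (\<Sum>k<n. (norm (taylor_coef f k))\<^sup>2)"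
      using r by (intro sum_mono) (auto simp: mult_left_le power_le_one)
    also have "\<dots> \<le> (h2norm f)\<^sup>2" by (rule sum_taylor_coef_le_h2norm[OF f])
    finally show ?thesis .
  qed
  show ?thesis
    unfolding circle_mean_def by (rule LIMSEQ_le_const2[OF lim2]) (use bnd in blast)
qed

text \<open>Cauchy's formula is applied to the square of \<open>f\<close>, with the kernel bounded
  by \<open>1 / (r - norm z)\<close>. The factor is cruder than the Poisson kernel but independent
  of \<open>f\<close>.\<close>

lemma norm_squared_le_circle_mean:
  assumes hol: "f holomorphic_on ball 0 1" and z: "norm z < r" and r: "r < 1"
  shows "(norm (f z))\<^sup>2 \<le> r / (r - norm z) * circle_mean r (\<lambda>z. (norm (f z))\<^sup>2)"
proof -
  have r0: "0 < r" using z norm_ge_zero[of z] by linarith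
  have nr: "norm (circlepath 0 r t) = r" for t using r0 by (simp add: circlepath norm_mult)
  let ?g = "\<lambda>t. (f (circlepath 0 r t))\<^sup>2 / (circlepath 0 r t - z) *
      (2 * of_real pi * \<i> * of_real r * exp (2 * of_real pi * \<i> * of_real t))"
  have "((\<lambda>u. (f u)\<^sup>2 / (u - z)) has_contour_integral 2 * of_real pi * \<i> * (f z)\<^sup>2) (circlepath 0 r)"
    by (rule Cauchy_integral_circlepath_simple)
       (use z r in \<open>auto intro!: holomorphic_intros holomorphic_on_subset[OF hol]\<close>)
  then have gi: "(?g has_integral 2 * of_real pi * \<i> * (f z)\<^sup>2) {0..1}"
    unfolding has_contour_integral_def
    by (rule has_integral_eq[rotated]) (auto simp: vector_derivative_circlepath01)
  let ?h = "\<lambda>t. 2 * pi * r / (r - norm z) * (norm (f (circlepath 0 r t)))\<^sup>2"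
  have hi: "?h integrable_on {0..1}"
    by (intro integrable_continuous_real continuous_intros continuous_on_circlepath_compose
         holomorphic_on_imp_continuous_on hol) (use r0 r in auto)
  have le: "norm (?g t) \<le> ?h t" for t
  proof -
    have "r - norm z \<le> norm (circlepath 0 r t - z)"
      using norm_triangle_ineq2[of "circlepath 0 r t" z] by (simp add: nr)
    then have "(norm (f (circlepath 0 r t)))\<^sup>2 / norm (circlepath 0 r t - z) \<le>
       (norm (f (circlepath 0 r t)))\<^sup>2 / (r - norm z)"
      using z by (intro divide_left_mono mult_pos_pos) auto
    then have "(norm (f (circlepath 0 r t)))\<^sup>2 / norm (circlepath 0 r t - z) * (2 * pi * r) \<le>
       (norm (f (circlepath 0 r t)))\<^sup>2 / (r - norm z) * (2 * pi * r)"
      using r0 by (intro mult_right_mono) auto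
    then show ?thesis
      using r0 by (simp add: norm_mult norm_divide norm_power mult_ac)
  qed
  have "norm (2 * of_real pi * \<i> * (f z)\<^sup>2) \<le> integral {0..1} ?h"
    using integral_norm_bound_integral[OF has_integral_integrable[OF gi] hi le] integral_unique[OF gi] by simp
  also have "\<dots> = 2 * pi * (r / (r - norm z) * circle_mean r (\<lambda>z. (norm (f z))\<^sup>2))"
    unfolding circle_mean_def by simp
  finally have "2 * pi * (norm (f z))\<^sup>2 \<le> 2 * pi * (r / (r - norm z) * circle_mean r (\<lambda>z. (norm (f z))\<^sup>2))"
    by (simp add: norm_mult norm_power)
  then show ?thesis by (rule mult_left_le_imp_le) simp
qed

lemma circle_mean_mono:
  assumes "continuous_on (ball 0 1) u" "continuous_on (ball 0 1) v" "0 \<le> r" "r < 1"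
    and "\<And>z. norm z = r \<Longrightarrow> u z \<le> v z"
  shows "circle_mean r u \<le> circle_mean r v"
  unfolding circle_mean_def
  by (intro integral_le integrable_continuous_real continuous_on_circlepath_compose assms)
     (use assms in \<open>auto simp: circlepath norm_mult\<close>)

lemma circle_mean_add_cmult:
  assumes "continuous_on (ball 0 1) u" "continuous_on (ball 0 1) v" "0 \<le> r" "r < 1"
  shows "circle_mean r (\<lambda>z. a * u z + b * v z) = a * circle_mean r u + b * circle_mean r v"
  unfolding circle_mean_def
  by (subst integral_add)
     (auto intro!: integrable_continuous_real continuous_intros continuous_on_circlepath_compose assms)

section \<open>The symbol\<close>

lemma Re_csqrt_squared: "(Re (csqrt s))\<^sup>2 = (norm s + Re s) / 2"
  using abs_Re_le_cmod[of s] by (simp add: real_sqrt_pow2)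

lemma Re_power2_add: "Re (w\<^sup>2 + (of_real c)\<^sup>2) = (Re w)\<^sup>2 - (Im w)\<^sup>2 + c\<^sup>2"
  by (simp add: power2_eq_square)

lemma norm_power2_add_squared:
  "(norm (w\<^sup>2 + (of_real c)\<^sup>2))\<^sup>2 = ((norm w)\<^sup>2 - c\<^sup>2)\<^sup>2 + 4 * (Re w)\<^sup>2 * c\<^sup>2"
  unfolding cmod_power2 by (simp add: power2_eq_square algebra_simps)

text \<open>This reduces every comparison of the root with \<open>Re w\<close> to a bound on the
  modulus of \<open>w\<^sup>2 + c\<^sup>2\<close>, whose square is explicit.\<close>

lemma Re_csqrt_power2_add_squared:
  "(Re (csqrt (w\<^sup>2 + (of_real c)\<^sup>2)))\<^sup>2 = (Re w)\<^sup>2 + (norm (w\<^sup>2 + (of_real c)\<^sup>2) - ((norm w)\<^sup>2 - c\<^sup>2)) / 2"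
  unfolding Re_csqrt_squared Re_power2_add cmod_power2[of w] by (simp add: field_simps)

lemma Re_csqrt_nonneg: "0 \<le> Re (csqrt s)"
  using abs_Re_le_cmod[of s] by simp

lemma Re_csqrt_power2_add_ge: "Re w \<le> Re (csqrt (w\<^sup>2 + (of_real c)\<^sup>2))"
proof (rule power2_le_imp_le[OF _ Re_csqrt_nonneg])
  have "(norm w)\<^sup>2 \<le> norm (w\<^sup>2 + (of_real c)\<^sup>2) + c\<^sup>2"
    using norm_triangle_ineq4[of "w\<^sup>2 + (of_real c)\<^sup>2" "(of_real c)\<^sup>2"] by (simp add: norm_power)
  then show "(Re w)\<^sup>2 \<le> (Re (csqrt (w\<^sup>2 + (of_real c)\<^sup>2)))\<^sup>2"
    unfolding Re_csqrt_power2_add_squared by simp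
qed

lemma Re_csqrt_power2_add_le:
  assumes "0 \<le> Re w" "0 \<le> c"
  shows "Re (csqrt (w\<^sup>2 + (of_real c)\<^sup>2)) \<le> Re w + c"
proof (rule power2_le_imp_le)
  have "norm (w\<^sup>2 + (of_real c)\<^sup>2) \<le> (norm w)\<^sup>2 + c\<^sup>2"
    using norm_triangle_ineq[of "w\<^sup>2" "(of_real c)\<^sup>2"] by (simp add: norm_power)
  moreover have "0 \<le> Re w * c" using assms by simp
  ultimately show "(Re (csqrt (w\<^sup>2 + (of_real c)\<^sup>2)))\<^sup>2 \<le> (Re w + c)\<^sup>2"
    unfolding Re_csqrt_power2_add_squared power2_sum by simp
qed (use assms in auto)

text \<open>This decay for large \<open>w\<close> makes the slit potentials continuous at the point
  \<open>1\<close>, which \<open>cayley\<close> sends to infinity.\<close>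

lemma Re_csqrt_power2_add_le_decay:
  assumes "0 \<le> Re w" "w \<noteq> 0" "2 * c\<^sup>2 \<le> (norm w)\<^sup>2"
  shows "Re (csqrt (w\<^sup>2 + (of_real c)\<^sup>2)) \<le> Re w + c\<^sup>2 / norm w"
proof -
  define a m where "a = Re w" and "m = (norm w)\<^sup>2"
  have m: "0 < m" and mc: "2 * c\<^sup>2 \<le> m" using assms by (auto simp: m_def)
  \<comment> \<open>\<open>Y\<close> is large enough that \<open>2 * (m - c\<^sup>2) * Y\<close>
    dominates the cross term \<open>4 * a\<^sup>2 * c\<^sup>2\<close>, because
    \<open>m - c\<^sup>2 \<ge> m / 2\<close>.\<close>
  define Y where "Y = 4 * a\<^sup>2 * c\<^sup>2 / m"
  have Y0: "0 \<le> Y" using m by (simp add: Y_def)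
  have "norm (w\<^sup>2 + (of_real c)\<^sup>2) \<le> (m - c\<^sup>2) + Y"
  proof (rule power2_le_imp_le)
    have "4 * a\<^sup>2 * c\<^sup>2 * (2 * c\<^sup>2) \<le> 4 * a\<^sup>2 * c\<^sup>2 * m"
      by (intro mult_left_mono mc) auto
    then have "4 * a\<^sup>2 * c\<^sup>2 \<le> 2 * (m - c\<^sup>2) * Y"
      using m by (simp add: Y_def field_simps)
    then show "(norm (w\<^sup>2 + (of_real c)\<^sup>2))\<^sup>2 \<le> ((m - c\<^sup>2) + Y)\<^sup>2"
      unfolding norm_power2_add_squared power2_sum[of "m - c\<^sup>2" Y] m_def[symmetric] a_def[symmetric]
      using zero_le_power2[of Y] by linarith
    show "0 \<le> (m - c\<^sup>2) + Y" using mc Y0 zero_le_power2[of c] by linarith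
  qed
  then have "(Re (csqrt (w\<^sup>2 + (of_real c)\<^sup>2)))\<^sup>2 \<le> a\<^sup>2 + Y / 2"
    unfolding Re_csqrt_power2_add_squared m_def[symmetric] a_def[symmetric] by simp
  also have "\<dots> \<le> (a + a * c\<^sup>2 / m)\<^sup>2"
  proof -
    have "Y / 2 = 2 * a * (a * c\<^sup>2 / m)" by (simp add: Y_def power2_eq_square)
    then show ?thesis
      unfolding power2_sum[of a] using zero_le_power2[of "a * c\<^sup>2 / m"] by linarith
  qed
  finally have "Re (csqrt (w\<^sup>2 + (of_real c)\<^sup>2)) \<le> a + a * c\<^sup>2 / m"
    by (rule power2_le_imp_le) (use assms m in \<open>auto simp: a_def\<close>)
  also have "a * c\<^sup>2 / m \<le> norm w * c\<^sup>2 / m"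
    using m complex_Re_le_cmod[of w] by (intro divide_right_mono mult_right_mono) (auto simp: a_def)
  also have "\<dots> = c\<^sup>2 / norm w" using assms by (simp add: m_def power2_eq_square)
  finally show ?thesis by (simp add: a_def)
qed

text \<open>The gain over \<open>Re w\<close> is of order \<open>c\<^sup>2\<close>. This will bound
  the auxiliary outer function from below at a fixed interior point while its arc shrinks.\<close>

lemma Re_csqrt_power2_add_ge_strict:
  assumes "0 \<le> Re w" "w \<noteq> 0" "c\<^sup>2 \<le> 3 * (norm w)\<^sup>2"
  shows "Re w + Re w * c\<^sup>2 / (3 * (norm w)\<^sup>2) \<le> Re (csqrt (w\<^sup>2 + (of_real c)\<^sup>2))"
proof (rule power2_le_imp_le[OF _ Re_csqrt_nonneg])
  define a m where "a = Re w" and "m = (norm w)\<^sup>2"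
  have m: "0 < m" and mc: "c\<^sup>2 \<le> 3 * m" using assms by (auto simp: m_def)
  have am: "a\<^sup>2 \<le> m" by (simp add: a_def m_def cmod_power2)
  \<comment> \<open>Half the constant of the upper estimate: the error \<open>Y\<^sup>2\<close> is
    then absorbed by the negative part of \<open>2 * (m - c\<^sup>2) * Y\<close>, using
    \<open>a\<^sup>2 \<le> m\<close>.\<close>
  define Y where "Y = 2 * a\<^sup>2 * c\<^sup>2 / m"
  have Y0: "0 \<le> Y" using m by (simp add: Y_def)
  have "(m - c\<^sup>2) + Y \<le> norm (w\<^sup>2 + (of_real c)\<^sup>2)"
  proof (rule power2_le_imp_le[OF _ norm_ge_zero])
    have "a\<^sup>2 * (a\<^sup>2 * c ^ 4) \<le> m * (a\<^sup>2 * c ^ 4)"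
      by (intro mult_right_mono am) auto
    then have "Y\<^sup>2 \<le> 4 * a\<^sup>2 * c ^ 4 / m"
      using m by (simp add: Y_def field_simps power2_eq_square power4_eq_xxxx)
    moreover have "2 * (m - c\<^sup>2) * Y = 4 * a\<^sup>2 * c\<^sup>2 - 4 * a\<^sup>2 * c ^ 4 / m"
      using m by (simp add: Y_def field_simps power2_eq_square power4_eq_xxxx)
    ultimately show "((m - c\<^sup>2) + Y)\<^sup>2 \<le> (norm (w\<^sup>2 + (of_real c)\<^sup>2))\<^sup>2"
      unfolding norm_power2_add_squared power2_sum[of "m - c\<^sup>2" Y] m_def[symmetric] a_def[symmetric]
      by linarith
  qed
  then have "a\<^sup>2 + Y / 2 \<le> (Re (csqrt (w\<^sup>2 + (of_real c)\<^sup>2)))\<^sup>2"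
    unfolding Re_csqrt_power2_add_squared m_def[symmetric] a_def[symmetric] by simp
  moreover have "(a + a * c\<^sup>2 / (3 * m))\<^sup>2 \<le> a\<^sup>2 + Y / 2"
  proof -
    \<comment> \<open>In terms of \<open>t\<close> the claim reads
      \<open>2 * t / 3 + t\<^sup>2 / 9 \<le> t\<close>, which is exactly \<open>t \<le> 3\<close>
      for positive \<open>t\<close>; this fixes the constant 3 of the lemma.\<close>
    define t where "t = c\<^sup>2 / m"
    have t: "0 \<le> t" "t \<le> 3" using m mc by (auto simp: t_def field_simps)
    have "t * t \<le> 3 * t" using t by (intro mult_right_mono) auto
    then have "a\<^sup>2 * (1 + 2 * t / 3 + t * t / 9) \<le> a\<^sup>2 * (1 + t)"
      by (intro mult_left_mono) auto
    moreover have "(a + a * c\<^sup>2 / (3 * m))\<^sup>2 = a\<^sup>2 * (1 + 2 * t / 3 + t * t / 9)"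
      using m by (simp add: t_def field_simps power2_eq_square)
    moreover have "a\<^sup>2 + Y / 2 = a\<^sup>2 * (1 + t)"
      by (simp add: Y_def t_def field_simps)
    ultimately show ?thesis by simp
  qed
  ultimately show "(Re w + Re w * c\<^sup>2 / (3 * (norm w)\<^sup>2))\<^sup>2 \<le> (Re (csqrt (w\<^sup>2 + (of_real c)\<^sup>2)))\<^sup>2"
    by (simp add: a_def m_def)
qed

text \<open>For \<open>w = \<i> * y\<close> the radicand \<open>c\<^sup>2 - y\<^sup>2\<close> is
  real, and its root is purely imaginary exactly when the radicand is not positive.\<close>

lemma Re_csqrt_power2_add_imaginary:
  assumes "Re w = 0" "0 \<le> c"
  shows "Re (csqrt (w\<^sup>2 + (of_real c)\<^sup>2)) = 0 \<longleftrightarrow> c \<le> norm w"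
proof -
  have e: "(norm (w\<^sup>2 + (of_real c)\<^sup>2))\<^sup>2 = ((norm w)\<^sup>2 - c\<^sup>2)\<^sup>2"
    using assms by (simp add: norm_power2_add_squared)
  have n: "norm (w\<^sup>2 + (of_real c)\<^sup>2) = \<bar>(norm w)\<^sup>2 - c\<^sup>2\<bar>"
    by (rule power2_eq_imp_eq[OF _ norm_ge_zero abs_ge_zero]) (simp only: e power2_abs)
  have "Re (csqrt (w\<^sup>2 + (of_real c)\<^sup>2)) = 0 \<longleftrightarrow> (Re (csqrt (w\<^sup>2 + (of_real c)\<^sup>2)))\<^sup>2 = 0"
    by (simp only: power_eq_0_iff zero_less_numeral simp_thms)
  also have "\<dots> \<longleftrightarrow> 0 \<le> (norm w)\<^sup>2 - c\<^sup>2"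
  proof -
    have "(0::real)\<^sup>2 + (\<bar>t\<bar> - t) / 2 = 0 \<longleftrightarrow> 0 \<le> t" for t by auto
    then show ?thesis unfolding Re_csqrt_power2_add_squared n assms(1) .
  qed
  also have "\<dots> \<longleftrightarrow> c \<le> norm w"
    using assms(2) abs_le_square_iff[of c "norm w"] by (simp only: le_diff_eq add_0 abs_norm_cancel abs_of_nonneg)
  finally show ?thesis .
qed

section \<open>The Cayley transform, with \<open>1\<close> sent to infinity and \<open>-1\<close> to
  \<open>0\<close>, and the slit potentials\<close>

definition cayley :: "complex \<Rightarrow> complex" where
  "cayley z = (1 + z) / (1 - z)"

text \<open>The map \<open>w \<mapsto> csqrt (w\<^sup>2 + c\<^sup>2)\<close> sends the right half-plane onto itself minus the slit \<open>(0, c]\<close>.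
  Subtracting \<open>w\<close> removes the singularity at infinity: the real part becomes bounded, with boundary
  values \<open>sqrt (c\<^sup>2 - y\<^sup>2)\<close> at \<open>\<i> y\<close> for \<open>\<bar>y\<bar> \<le> c\<close> and \<open>0\<close> elsewhere.\<close>
definition slit_map :: "real \<Rightarrow> complex \<Rightarrow> complex" where
  "slit_map c z = csqrt ((cayley z)\<^sup>2 + (of_real c)\<^sup>2) - cayley z"

text \<open>The value at \<open>z = 1\<close> is the limit; \<open>cayley 1 = 0\<close> by the convention for division by zero.\<close>
definition slit_potential :: "real \<Rightarrow> complex \<Rightarrow> real" where
  "slit_potential c z = (if z = 1 then 0 else Re (slit_map c z))"

lemma Re_cayley: "Re (cayley z) = (1 - (norm z)\<^sup>2) / (norm (1 - z))\<^sup>2"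
  unfolding cayley_def Re_divide cmod_power2
  by (simp add: power2_eq_square algebra_simps)

lemma Re_cayley_nonneg: "norm z \<le> 1 \<Longrightarrow> 0 \<le> Re (cayley z)"
  by (simp add: Re_cayley power_le_one)

lemma Re_cayley_pos: "norm z < 1 \<Longrightarrow> 0 < Re (cayley z)"
  by (auto simp: Re_cayley abs_square_less_1 intro!: divide_pos_pos)

lemma Re_cayley_sphere: "norm z = 1 \<Longrightarrow> Re (cayley z) = 0"
  by (simp add: Re_cayley)

lemma cayley_minus: "cayley (- z) = inverse (cayley z)"
  by (simp add: cayley_def)

lemma Re_slit_map: "Re (slit_map c z) = Re (csqrt ((cayley z)\<^sup>2 + (of_real c)\<^sup>2)) - Re (cayley z)"
  by (simp add: slit_map_def)

lemma slit_map_holomorphic: "slit_map c holomorphic_on ball 0 1"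
proof -
  have ch: "cayley holomorphic_on ball 0 1"
    unfolding cayley_def by (auto intro!: holomorphic_intros)
  \<comment> \<open>The radicand avoids the branch cut: as \<open>Re (cayley z) > 0\<close>, it is
    real only for real \<open>cayley z\<close>, and then it is positive.\<close>
  have nn: "(cayley z)\<^sup>2 + (of_real c)\<^sup>2 \<notin> \<real>\<^sub>\<le>\<^sub>0" if "z \<in> ball 0 1" for z
  proof
    assume *: "(cayley z)\<^sup>2 + (of_real c)\<^sup>2 \<in> \<real>\<^sub>\<le>\<^sub>0"
    have a: "0 < Re (cayley z)" using that by (simp add: Re_cayley_pos)
    have "Im ((cayley z)\<^sup>2 + (of_real c)\<^sup>2) = 2 * Re (cayley z) * Im (cayley z)"
      by (simp add: power2_eq_square)
    with * a have "Im (cayley z) = 0" by (simp add: complex_nonpos_Reals_iff)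
    then have "Re ((cayley z)\<^sup>2 + (of_real c)\<^sup>2) > 0"
      using a unfolding Re_power2_add by (simp add: add_pos_nonneg)
    with * show False by (simp add: complex_nonpos_Reals_iff)
  qed
  show ?thesis unfolding slit_map_def
    by (intro holomorphic_intros ch) (use nn in auto)
qed

lemma slit_potential_ball: "norm z < 1 \<Longrightarrow> slit_potential c z = Re (slit_map c z)"
  by (auto simp: slit_potential_def)

lemma slit_potential_nonneg: "0 \<le> slit_potential c z"
  by (simp add: slit_potential_def Re_slit_map Re_csqrt_power2_add_ge del: csqrt.sel)

lemma slit_potential_le:
  assumes "norm z \<le> 1" "0 \<le> c"
  shows "slit_potential c z \<le> c"
  using Re_csqrt_power2_add_le[OF Re_cayley_nonneg[OF assms(1)] assms(2)] assms(2)
  by (simp add: slit_potential_def Re_slit_map del: csqrt.sel)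

text \<open>The potential vanishes on the circle near \<open>1\<close>: \<open>cayley z\<close> is
  imaginary there, and for large \<open>c\<close> the zero arc has length of order
  \<open>1 / c\<close>.\<close>

lemma slit_potential_sphere:
  assumes "norm z = 1" "z \<noteq> 1" "0 \<le> c"
  shows "slit_potential c z = 0 \<longleftrightarrow> c \<le> norm (cayley z)"
  using Re_csqrt_power2_add_imaginary[OF Re_cayley_sphere[OF assms(1)] assms(3)] assms
  by (simp add: slit_potential_def Re_slit_map Re_cayley_sphere del: csqrt.sel)

lemma slit_potential_lower_bound:
  assumes "norm z < 1" "c\<^sup>2 \<le> 3 * (norm (cayley z))\<^sup>2"
  shows "Re (cayley z) * c\<^sup>2 / (3 * (norm (cayley z))\<^sup>2) \<le> slit_potential c z"
proof -
  have a: "0 < Re (cayley z)" using assms(1) by (rule Re_cayley_pos)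
  then have "cayley z \<noteq> 0" by auto
  from Re_csqrt_power2_add_ge_strict[OF less_imp_le[OF a] this assms(2)]
  show ?thesis unfolding slit_potential_ball[OF assms(1)] Re_slit_map by linarith
qed

lemma continuous_on_slit_potential: "continuous_on (cball 0 1) (slit_potential c)"
proof -
  have cc: "continuous_on (- {1}) cayley"
    unfolding cayley_def by (auto intro!: continuous_intros)
  have "continuous_on (- {1}) (\<lambda>z. Re (slit_map c z))"
  proof -
    \<comment> \<open>\<open>csqrt\<close> jumps across the negative axis, but its real part is
      continuous everywhere, which gives continuity up to the circle.\<close>
    have "Re (csqrt s) = sqrt ((norm s + Re s) / 2)" for s by simp
    then have e: "(\<lambda>z. Re (slit_map c z)) = (\<lambda>z. sqrt ((norm ((cayley z)\<^sup>2 + (of_real c)\<^sup>2) +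
        Re ((cayley z)\<^sup>2 + (of_real c)\<^sup>2)) / 2) - Re (cayley z))"
      unfolding Re_slit_map by (simp only:)
    show ?thesis unfolding e by (intro continuous_intros cc) auto
  qed
  then have c1: "continuous_on (- {1}) (slit_potential c)"
    by (rule continuous_on_eq) (auto simp: slit_potential_def)
  have "continuous (at z within cball 0 1) (slit_potential c)" if z: "z \<in> cball 0 1" for z
  proof (cases "z = 1")
    case False
    then have "isCont (slit_potential c) z"
      using c1 by (simp add: continuous_on_eq_continuous_at open_Compl)
    then show ?thesis by (rule continuous_at_imp_continuous_at_within)
  next
    case True
    \<comment> \<open>At \<open>z = 1\<close> the decay estimate yields the majorant
      \<open>c\<^sup>2 / norm (cayley z)\<close>, which tends to \<open>0\<close>.\<close>
    have "((\<lambda>z::complex. c\<^sup>2 * norm (1 - z) / norm (1 + z)) \<longlongrightarrow> c\<^sup>2 * norm (1 - 1::complex) / norm (1 + 1::complex)) (at 1 within cball 0 1)"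
      by (intro tendsto_intros) auto
    then have lim: "((\<lambda>z. c\<^sup>2 * norm (1 - z) / norm (1 + z)) \<longlongrightarrow> 0) (at (1::complex) within cball 0 1)" by simp
    have "((\<lambda>z::complex. 2 * c\<^sup>2 * (norm (1 - z))\<^sup>2 - (norm (1 + z))\<^sup>2) \<longlongrightarrow> 2 * c\<^sup>2 * (norm (1 - 1::complex))\<^sup>2 - (norm (1 + 1::complex))\<^sup>2) (at 1 within cball 0 1)"
      by (intro tendsto_intros)
    then have "eventually (\<lambda>z::complex. 2 * c\<^sup>2 * (norm (1 - z))\<^sup>2 - (norm (1 + z))\<^sup>2 < 0) (at 1 within cball 0 1)"
      by (rule order_tendstoD) simp
    moreover have "eventually (\<lambda>z::complex. z \<noteq> 1 \<and> z \<in> cball 0 1) (at 1 within cball 0 1)"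
      by (auto simp: eventually_at_filter)
    ultimately have ev: "eventually (\<lambda>z. slit_potential c z \<le> c\<^sup>2 * norm (1 - z) / norm (1 + z)) (at 1 within cball 0 1)"
    proof eventually_elim
      case (elim z)
      have nz: "norm (1 - z) > 0" using elim by auto
      have nw: "norm (cayley z) = norm (1 + z) / norm (1 - z)" by (simp add: cayley_def norm_divide)
      have "0 \<le> 2 * c\<^sup>2 * (norm (1 - z))\<^sup>2" by simp
      with elim(1) have "0 < (norm (1 + z))\<^sup>2" by linarith
      then have "1 + z \<noteq> 0" by auto
      then have "cayley z \<noteq> 0" using nz by (auto simp: cayley_def)
      moreover have "2 * c\<^sup>2 \<le> (norm (cayley z))\<^sup>2"
        using elim nz by (simp add: nw power_divide field_simps)
      ultimately have "Re (csqrt ((cayley z)\<^sup>2 + (of_real c)\<^sup>2)) \<le> Re (cayley z) + c\<^sup>2 / norm (cayley z)"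
        using elim by (intro Re_csqrt_power2_add_le_decay Re_cayley_nonneg) auto
      then have "slit_potential c z \<le> c\<^sup>2 / norm (cayley z)"
        using elim by (simp add: slit_potential_def Re_slit_map del: csqrt.sel)
      then show ?case by (simp add: nw)
    qed
    have "(slit_potential c \<longlongrightarrow> 0) (at 1 within cball 0 1)"
      by (rule tendsto_sandwich[OF _ ev tendsto_const lim]) (simp add: slit_potential_nonneg)
    then show ?thesis unfolding True continuous_within by (simp add: slit_potential_def)
  qed
  then show ?thesis by (simp add: continuous_on_eq_continuous_within)
qed

section \<open>The symbol as the exponential of a weighted sum of slit maps\<close>

text \<open>\<open>symbol_weight 0 = 0\<close>, since division by zero gives zero.\<close>
definition symbol_weight :: "nat \<Rightarrow> real" where
  "symbol_weight k = (1 / 2) ^ (k\<^sup>2) / real k"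

text \<open>This is \<open>g\<close> of \<open>\<phi> = exp (-g)\<close>. The division by
  \<open>k\<close> in the weight offsets \<open>slit_potential (real k) z \<le> k\<close>, so term
  \<open>k\<close> has real part at most \<open>(1 / 2) ^ (k\<^sup>2)\<close>.\<close>

definition symbol_exponent :: "complex \<Rightarrow> complex" where
  "symbol_exponent z = (\<Sum>k. of_real (symbol_weight k) * slit_map (real k) z)"

text \<open>The real part of \<open>symbol_exponent\<close> in the disc, extended to the closed
  disc, where radial limits and arcs are studied.\<close>

definition symbol_potential :: "complex \<Rightarrow> real" where
  "symbol_potential z = (\<Sum>k. symbol_weight k * slit_potential (real k) z)"

definition symbol :: "complex \<Rightarrow> complex" where
  "symbol z = exp (- symbol_exponent z)"

text \<open>Equality in \<open>Re_csqrt_power2_add_ge\<close> would force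
  \<open>Re w * c = 0\<close>.\<close>

lemma slit_potential_pos:
  assumes "norm z < 1" "c \<noteq> 0"
  shows "0 < slit_potential c z"
proof (rule ccontr)
  define w where "w = cayley z"
  assume "\<not> ?thesis"
  with slit_potential_nonneg[of c z] have "slit_potential c z = 0" by linarith
  then have "Re (csqrt (w\<^sup>2 + (of_real c)\<^sup>2)) = Re w"
    by (simp add: slit_potential_ball[OF assms(1)] Re_slit_map w_def del: csqrt.sel)
  with Re_csqrt_power2_add_squared[of w c] have "norm (w\<^sup>2 + (of_real c)\<^sup>2) = (norm w)\<^sup>2 - c\<^sup>2" by simp
  with norm_power2_add_squared[of w c] have "4 * (Re w)\<^sup>2 * c\<^sup>2 = 0" by simp
  with assms Re_cayley_pos[OF assms(1)] show False by (simp add: w_def)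
qed

lemma norm_slit_map_le:
  assumes "0 \<le> c"
  shows "norm (slit_map c z) \<le> 2 * norm (cayley z) + c"
proof -
  define w where "w = cayley z"
  have "(norm (csqrt (w\<^sup>2 + (of_real c)\<^sup>2)))\<^sup>2 = norm (w\<^sup>2 + (of_real c)\<^sup>2)"
    by (simp add: norm_power[symmetric])
  also have "\<dots> \<le> (norm w)\<^sup>2 + c\<^sup>2"
    using norm_triangle_ineq[of "w\<^sup>2" "(of_real c)\<^sup>2"] by (simp add: norm_power)
  also have "\<dots> \<le> (norm w + c)\<^sup>2" using assms by (simp add: power2_sum)
  finally have "norm (csqrt (w\<^sup>2 + (of_real c)\<^sup>2)) \<le> norm w + c"
    by (rule power2_le_imp_le) (use assms in auto)
  then show ?thesis
    using norm_triangle_ineq4[of "csqrt (w\<^sup>2 + (of_real c)\<^sup>2)" w] by (simp add: slit_map_def w_def)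
qed

lemma symbol_weight_nonneg: "0 \<le> symbol_weight k"
  by (simp add: symbol_weight_def)

lemma symbol_weight_pos: "0 < k \<Longrightarrow> 0 < symbol_weight k"
  by (simp add: symbol_weight_def)

lemma symbol_weight_le: "symbol_weight k * real k \<le> (1 / 2) ^ (k\<^sup>2)" "symbol_weight k \<le> (1 / 2) ^ (k\<^sup>2)"
proof -
  show "symbol_weight k * real k \<le> (1 / 2) ^ (k\<^sup>2)"
    by (cases "k = 0") (auto simp: symbol_weight_def)
  show "symbol_weight k \<le> (1 / 2) ^ (k\<^sup>2)"
    by (cases "k = 0") (auto simp: symbol_weight_def field_simps)
qed

lemma half_power_square_le: "(1 / 2 :: real) ^ (k\<^sup>2) \<le> (1 / 2) ^ k"
  by (rule power_decreasing) (auto simp: power2_eq_square)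

lemma symbol_term_le:
  assumes "norm z \<le> 1"
  shows "symbol_weight k * slit_potential (real k) z \<le> (1 / 2) ^ (k\<^sup>2)"
  using mult_left_mono[OF slit_potential_le[OF assms, of "real k"] symbol_weight_nonneg[of k]]
    symbol_weight_le(1)[of k] by linarith

lemma symbol_term_nonneg: "0 \<le> symbol_weight k * slit_potential (real k) z"
  by (simp add: symbol_weight_nonneg slit_potential_nonneg)

lemma summable_symbol_potential:
  assumes "norm z \<le> 1"
  shows "summable (\<lambda>k. symbol_weight k * slit_potential (real k) z)"
  by (rule summable_comparison_test'[of "\<lambda>k. (1 / 2) ^ k" 0])
     (use order_trans[OF symbol_term_le[OF assms] half_power_square_le] symbol_term_nonneg
      in \<open>auto simp: summable_geometric\<close>)

lemma symbol_potential_ge_term: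
  assumes "norm z \<le> 1"
  shows "symbol_weight k * slit_potential (real k) z \<le> symbol_potential z"
  using sum_le_suminf[OF summable_symbol_potential[OF assms], of "{k}"] symbol_term_nonneg
  unfolding symbol_potential_def by simp

lemma symbol_potential_pos:
  assumes "norm z < 1"
  shows "0 < symbol_potential z"
proof -
  have "0 < symbol_weight 1 * slit_potential (real 1) z"
    using assms by (intro mult_pos_pos symbol_weight_pos slit_potential_pos) auto
  also have "\<dots> \<le> symbol_potential z" using assms by (intro symbol_potential_ge_term) simp
  finally show ?thesis .
qed

text \<open>Any slit longer than \<open>norm (cayley z)\<close> contributes a positive term, and the
  slits \<open>k\<close> are unbounded.\<close>

lemma symbol_potential_sphere_pos:
  assumes "norm z = 1" "z \<noteq> 1"
  shows "0 < symbol_potential z"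
proof -
  obtain k :: nat where k: "norm (cayley z) < real k" using reals_Archimedean2 by blast
  then have k0: "0 < k" by (rule_tac Nat.gr0I) (auto simp: not_less)
  have "slit_potential (real k) z \<noteq> 0" using slit_potential_sphere[OF assms, of "real k"] k by simp
  then have "0 < symbol_weight k * slit_potential (real k) z"
    using slit_potential_nonneg[of "real k" z] symbol_weight_pos[OF k0] by simp
  then show ?thesis using symbol_potential_ge_term[of z k] assms by simp
qed

text \<open>The terms with \<open>k \<le> K\<close> vanish, and the tail is dominated by a geometric
  series because \<open>(n + K + 1)\<^sup>2 \<ge> K\<^sup>2 + n + 1\<close>. The point
  \<open>1\<close> is listed apart because \<open>cayley 1 = 0\<close> by convention.\<close>

lemma symbol_potential_sphere_le:
  assumes z: "norm z = 1" and K: "z = 1 \<or> real K \<le> norm (cayley z)"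
  shows "symbol_potential z \<le> (1 / 2) ^ (K\<^sup>2)"
proof -
  let ?f = "\<lambda>k. symbol_weight k * slit_potential (real k) z"
  have 0: "?f k = 0" if "k < Suc K" for k
  proof (cases "z = 1")
    case False
    then show ?thesis using slit_potential_sphere[OF z False, of "real k"] K that by auto
  qed (simp add: slit_potential_def)
  have sm: "summable ?f" using summable_symbol_potential z by simp
  have "(\<Sum>k<Suc K. ?f k) = 0" by (rule sum.neutral) (use 0 in auto)
  then have "symbol_potential z = (\<Sum>n. ?f (n + Suc K))"
    unfolding symbol_potential_def suminf_split_initial_segment[OF sm, of "Suc K"] by linarith
  also have "\<dots> \<le> (\<Sum>n. (1 / 2) ^ (K\<^sup>2) * (1 / 2) ^ Suc n)"
  proof (rule suminf_le)
    fix n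
    have "?f (n + Suc K) \<le> (1 / 2) ^ ((n + Suc K)\<^sup>2)" by (rule symbol_term_le) (simp add: z)
    also have "\<dots> \<le> (1 / 2) ^ (K\<^sup>2 + Suc n)"
      by (rule power_decreasing) (auto simp: power2_eq_square algebra_simps)
    finally show "?f (n + Suc K) \<le> (1 / 2) ^ (K\<^sup>2) * (1 / 2) ^ Suc n" by (simp only: power_add)
    show "summable (\<lambda>n. ?f (n + Suc K))" by (subst summable_iff_shift) (rule sm)
    show "summable (\<lambda>n. (1 / 2 :: real) ^ (K\<^sup>2) * (1 / 2) ^ Suc n)"
      by (intro summable_mult sums_summable[OF power_half_series])
  qed
  also have "\<dots> = (1 / 2) ^ (K\<^sup>2)"
    using sums_mult[OF power_half_series, of "(1 / 2) ^ (K\<^sup>2)"] by (simp add: sums_iff)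
  finally show ?thesis .
qed

lemma continuous_on_symbol_potential: "continuous_on (cball 0 1) symbol_potential"
proof -
  have ul: "uniform_limit (cball 0 1) (\<lambda>n z. \<Sum>k<n. symbol_weight k * slit_potential (real k) z)
      symbol_potential sequentially"
    unfolding symbol_potential_def
    by (rule Weierstrass_m_test[of _ _ "\<lambda>k. (1 / 2) ^ k"])
       (use order_trans[OF symbol_term_le half_power_square_le] symbol_term_nonneg
        in \<open>auto simp: summable_geometric\<close>)
  show ?thesis
    by (rule uniform_limit_theorem[OF _ ul])
       (auto intro!: always_eventually continuous_intros continuous_on_slit_potential)
qed

lemma symbol_exponent_term_le:
  assumes "norm (cayley z) \<le> B"
  shows "norm (of_real (symbol_weight k) * slit_map (real k) z) \<le> (2 * B + 1) * (1 / 2) ^ k"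
proof -
  have B: "0 \<le> B" using assms norm_ge_zero order_trans by blast
  have "norm (of_real (symbol_weight k) * slit_map (real k) z) \<le> symbol_weight k * (2 * B + real k)"
    using norm_slit_map_le[of "real k" z] assms symbol_weight_nonneg[of k]
    by (auto simp: norm_mult intro!: mult_left_mono)
  also have "\<dots> = 2 * B * symbol_weight k + symbol_weight k * real k" by (simp add: algebra_simps)
  also have "\<dots> \<le> 2 * B * (1 / 2) ^ (k\<^sup>2) + (1 / 2) ^ (k\<^sup>2)"
    using B by (intro add_mono mult_left_mono symbol_weight_le) auto
  also have "\<dots> = (2 * B + 1) * (1 / 2) ^ (k\<^sup>2)" by (simp add: algebra_simps)
  also have "\<dots> \<le> (2 * B + 1) * (1 / 2) ^ k"
    using B half_power_square_le by (intro mult_left_mono) auto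
  finally show ?thesis .
qed

text \<open>\<open>cayley\<close> is bounded on closed discs inside the unit disc, so the series
  converges uniformly there.\<close>

lemma symbol_exponent_holomorphic: "symbol_exponent holomorphic_on ball 0 1"
proof (rule holomorphic_uniform_sequence[OF open_ball])
  show "(\<lambda>z. \<Sum>k<n. of_real (symbol_weight k) * slit_map (real k) z) holomorphic_on ball 0 1" for n
    by (intro holomorphic_intros slit_map_holomorphic)
  fix x :: complex assume "x \<in> ball 0 1"
  then obtain d where d: "0 < d" "cball x d \<subseteq> ball 0 1" using open_contains_cball open_ball by blast
  have "continuous_on (cball x d) cayley"
    unfolding cayley_def using d(2) by (auto intro!: continuous_intros)
  then have "bounded (cayley ` cball x d)"
    by (intro compact_imp_bounded compact_continuous_image) auto
  then obtain B where B: "\<And>z. z \<in> cball x d \<Longrightarrow> norm (cayley z) \<le> B"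
    by (meson bounded_iff imageI)
  have "uniform_limit (cball x d) (\<lambda>n z. \<Sum>k<n. of_real (symbol_weight k) * slit_map (real k) z) symbol_exponent sequentially"
    unfolding symbol_exponent_def
    by (rule Weierstrass_m_test[OF symbol_exponent_term_le[OF B]])
       (auto intro!: summable_mult summable_geometric)
  with d show "\<exists>d>0. cball x d \<subseteq> ball 0 1 \<and>
      uniform_limit (cball x d) (\<lambda>n z. \<Sum>k<n. of_real (symbol_weight k) * slit_map (real k) z) symbol_exponent sequentially"
    by blast
qed

lemma symbol_holomorphic: "symbol holomorphic_on ball 0 1"
  unfolding symbol_def by (intro holomorphic_intros symbol_exponent_holomorphic)

lemma norm_symbol:
  assumes "norm z < 1"
  shows "norm (symbol z) = exp (- symbol_potential z)"
proof -
  have "summable (\<lambda>k. of_real (symbol_weight k) * slit_map (real k) z)"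
    by (rule summable_comparison_test'[of "\<lambda>k. (2 * norm (cayley z) + 1) * (1 / 2) ^ k" 0],
        intro summable_mult summable_geometric, simp, rule symbol_exponent_term_le[OF order_refl])
  from bounded_linear.suminf[OF bounded_linear_Re this]
  have "Re (symbol_exponent z) = symbol_potential z"
    by (simp add: symbol_exponent_def symbol_potential_def slit_potential_ball[OF assms])
  then show ?thesis by (simp add: symbol_def)
qed

text \<open>By continuity of the potential, the modulus of the symbol has radial limit
  \<open>exp (- symbol_potential (cis t))\<close>, which is \<open>1\<close> only at
  \<open>cis t = 1\<close>; both ends of the parameter interval give this point.\<close>

lemma unimodular_set_symbol: "unimodular_set symbol \<subseteq> {0, 2 * pi}"
proof
  fix t assume "t \<in> unimodular_set symbol"
  then obtain L where t: "0 \<le> t" "t \<le> 2 * pi" and L: "norm L = 1"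
    and lim: "((\<lambda>r::real. symbol (of_real r * cis t)) \<longlongrightarrow> L) (at_left 1)"
    by (auto simp: unimodular_set_def)
  have ev: "eventually (\<lambda>r::real. r \<in> {0<..<1}) (at_left 1)"
    by (rule eventually_at_left_real) simp
  have "((\<lambda>r::real. of_real r * cis t) \<longlongrightarrow> of_real 1 * cis t) (at_left 1)"
    by (intro tendsto_intros)
  then have "filterlim (\<lambda>r::real. of_real r * cis t) (at (cis t) within cball 0 1) (at_left 1)"
    unfolding filterlim_at
    by (auto intro: eventually_mono[OF ev] simp: norm_mult)
  moreover have "(symbol_potential \<longlongrightarrow> symbol_potential (cis t)) (at (cis t) within cball 0 1)"
    using continuous_on_symbol_potential by (simp add: continuous_on_def)
  ultimately have "((\<lambda>r. symbol_potential (of_real r * cis t)) \<longlongrightarrow> symbol_potential (cis t)) (at_left 1)"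
    by (rule filterlim_compose[rotated])
  then have "((\<lambda>r. exp (- symbol_potential (of_real r * cis t))) \<longlongrightarrow> exp (- symbol_potential (cis t))) (at_left 1)"
    by (intro tendsto_intros)
  moreover have "((\<lambda>r. exp (- symbol_potential (of_real r * cis t))) \<longlongrightarrow> norm L) (at_left 1)"
    by (rule Lim_transform_eventually[OF tendsto_norm[OF lim]])
       (auto intro!: eventually_mono[OF ev] simp: norm_symbol norm_mult)
  ultimately have "exp (- symbol_potential (cis t)) = norm L"
    by (rule tendsto_unique[rotated]) simp
  with L have "symbol_potential (cis t) = 0" by simp
  with symbol_potential_sphere_pos[of "cis t"] have "cis t = 1" by auto
  then have "cos t = 1" by (simp add: complex_eq_iff)
  then obtain n :: int where "t = of_int n * 2 * pi" using cos_one_2pi_int by blast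
  then have "real_of_int n = t / (2 * pi)" by simp
  moreover have "0 \<le> t / (2 * pi)" "t / (2 * pi) \<le> 1" using t by simp_all
  ultimately have "0 \<le> n" "n \<le> 1" by (simp_all only: of_int_0_le_iff of_int_le_1_iff flip: \<open>real_of_int n = t / (2 * pi)\<close>)
  then have "n = 0 \<or> n = 1" by linarith
  then show "t \<in> {0, 2 * pi}" using \<open>t = of_int n * 2 * pi\<close> by auto
qed

section \<open>Lower bounds for the singular numbers\<close>

text \<open>At a point of the circle either the potential of the symbol is tiny or the weight equals \<open>1\<close>,
  because \<open>cayley (- z) = inverse (cayley z)\<close> makes the two supports complementary.\<close>
lemma slit_weight_sphere_bound:
  assumes z: "norm z = 1" and K: "0 < K" and lam: "0 \<le> \<mu>"
  shows "exp (2 * \<mu> * slit_potential (1 / real K) (- z)) \<le>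
    1 + exp (2 * \<mu> / real K + 2) * exp (- 2 * 2 ^ (K\<^sup>2) * symbol_potential z)"
proof (cases "z = 1 \<or> real K \<le> norm (cayley z)")
  case True
  \<comment> \<open>Here the decaying exponential is at least \<open>exp (-2)\<close>; the summand
    \<open>2\<close> in the other exponent compensates for it.\<close>
  have "2 ^ (K\<^sup>2) * symbol_potential z \<le> 2 ^ (K\<^sup>2) * (1 / 2) ^ (K\<^sup>2)"
    using symbol_potential_sphere_le[OF z True] by (intro mult_left_mono) auto
  also have "\<dots> = 1" by (simp add: power_one_over)
  finally have u: "2 ^ (K\<^sup>2) * symbol_potential z \<le> 1" .
  have "\<mu> * slit_potential (1 / real K) (- z) \<le> \<mu> * (1 / real K)"
    using z by (intro mult_left_mono slit_potential_le lam) auto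
  with u have "exp (2 * \<mu> * slit_potential (1 / real K) (- z)) \<le>
      exp (2 * \<mu> / real K + 2 + (- 2 * 2 ^ (K\<^sup>2) * symbol_potential z))"
    by simp
  then show ?thesis by (simp only: exp_add)
next
  case False
  have "slit_potential (1 / real K) (- z) = 0"
  proof (cases "- z = 1")
    case False
    have "z \<noteq> - 1" using False by auto
    then have "1 + z \<noteq> 0" by (metis add.inverse_inverse add_eq_0_iff)
    moreover have "1 - z \<noteq> 0" using \<open>\<not> (z = 1 \<or> _)\<close> by auto
    ultimately have "0 < norm (cayley z)" by (simp add: cayley_def)
    moreover have "norm (cayley z) < real K" using \<open>\<not> (z = 1 \<or> _)\<close> by auto
    ultimately have "1 / real K \<le> norm (cayley (- z))"
      by (simp add: cayley_minus norm_divide inverse_eq_divide frac_le)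
    then show ?thesis using slit_potential_sphere[of "- z" "1 / real K"] z False by simp
  qed (simp add: slit_potential_def)
  then show ?thesis by simp
qed

text \<open>Raising the constant from \<open>1\<close> to \<open>2\<close> makes the bound on the
  circle strict, so continuity and compactness extend it to an annulus. The means can then be taken
  over circles inside the disc, without boundary values of the weight.\<close>

lemma slit_weight_annulus_bound:
  assumes K: "0 < K" and lam: "0 \<le> \<mu>"
  obtains r0 where "r0 < 1" "\<And>z. r0 \<le> norm z \<Longrightarrow> norm z < 1 \<Longrightarrow>
    exp (2 * \<mu> * slit_potential (1 / real K) (- z)) \<le>
    2 + exp (2 * \<mu> / real K + 2) * exp (- 2 * 2 ^ (K\<^sup>2) * symbol_potential z)"
proof -
  define G where "G z = 2 + exp (2 * \<mu> / real K + 2) * exp (- 2 * 2 ^ (K\<^sup>2) * symbol_potential z)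
     - exp (2 * \<mu> * slit_potential (1 / real K) (- z))" for z
  have "continuous_on (cball 0 1) (\<lambda>z. slit_potential (1 / real K) (- z))"
    by (rule continuous_on_compose2[OF continuous_on_slit_potential]) (auto intro!: continuous_intros)
  then have G: "continuous_on (cball 0 1) G"
    unfolding G_def by (intro continuous_intros continuous_on_symbol_potential)
  have pos: "0 < G z" if "norm z = 1" for z
    using slit_weight_sphere_bound[OF that K lam] by (simp add: G_def)
  \<comment> \<open>The compact set where the bound may fail misses the circle, so its largest
    modulus is below \<open>1\<close>.\<close>
  define Z where "Z = {z \<in> cball 0 1. G z \<le> 0}"
  have Z: "compact Z"
  proof -
    have "closed {z \<in> cball 0 1. G z \<in> {..0}}"
      using continuous_closed_preimage[OF G closed_cball closed_atMost[of 0]]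
      by (simp add: vimage_def Int_def)
    then show ?thesis unfolding Z_def compact_eq_bounded_closed
      by (auto intro: bounded_subset[OF bounded_cball[of 0 1]])
  qed
  show ?thesis
  proof (cases "Z = {}")
    case True
    have "0 \<le> G z" if "norm z < 1" for z
    proof -
      have "z \<notin> Z" using True by simp
      with that show ?thesis by (auto simp: Z_def)
    qed
    then show ?thesis by (intro that[of 0]) (auto simp: G_def)
  next
    case False
    obtain z1 where z1: "z1 \<in> Z" "\<And>z. z \<in> Z \<Longrightarrow> norm z \<le> norm z1"
      using continuous_attains_sup[OF Z False, of norm] by (auto intro: continuous_intros)
    have "norm z1 < 1" using z1(1) pos[of z1] by (force simp: Z_def)
    moreover have "0 \<le> G z" if "(norm z1 + 1) / 2 \<le> norm z" "norm z < 1" for z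
    proof -
      have "z \<notin> Z" using z1(2)[of z] that(1) \<open>norm z1 < 1\<close> by auto
      with that(2) show ?thesis by (auto simp: Z_def)
    qed
    ultimately show ?thesis by (intro that[of "(norm z1 + 1) / 2"]) (auto simp: G_def)
  qed
qed

text \<open>The auxiliary outer function is the exponential of
  \<open>\<mu> * slit_map (1 / real K) (- z)\<close>, with \<open>\<mu>\<close> proportional to
  \<open>K\<^sup>2\<close>. Its modulus on the arc is at most exponential in \<open>K\<close>, while
  at \<open>z0\<close> it stays above a constant that can be prescribed.\<close>

lemma h2norm_weight_times_symbol_power_ge:
  assumes w: "w \<in> H2" and z0: "norm z0 < 1" "w z0 \<noteq> 0"
  obtains c L where "0 < c" "0 \<le> L"
    "eventually (\<lambda>K. \<forall>j \<le> 2 ^ (K\<^sup>2). (\<lambda>z. w z * symbol z ^ j) \<in> H2 \<longrightarrow>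
       c * exp (- L * real K) \<le> (h2norm (\<lambda>z. w z * symbol z ^ j))\<^sup>2) sequentially"
proof -
  define v where "v = cayley (- z0)"
  have a: "0 < Re v" using z0 by (simp add: v_def Re_cayley_pos)
  then have m: "0 < (norm v)\<^sup>2" by auto
  define \<kappa> where "\<kappa> = Re v / (3 * (norm v)\<^sup>2)"
  define C where "C = 2 / (1 - norm z0)"
  define W where "W = (h2norm w)\<^sup>2"
  define q where "q = (norm (w z0))\<^sup>2"
  have pos: "0 < \<kappa>" "0 < C" "0 \<le> W" "0 < q"
    using a m z0 by (auto simp: \<kappa>_def C_def W_def q_def)
  \<comment> \<open>Chosen so that \<open>2 * \<Lambda> * \<kappa> = 4 * C * W / q\<close>; then
    \<open>1 + x \<le> exp x\<close> makes the value at \<open>z0\<close> outweigh the contribution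
    \<open>2 * C * W\<close> from off the arc.\<close>
  define \<Lambda> where "\<Lambda> = 4 * C * W / q / (2 * \<kappa>)"
  have \<Lambda>: "0 \<le> \<Lambda>" using pos by (simp add: \<Lambda>_def)
  have q\<Lambda>: "4 * C * W + q \<le> q * exp (2 * \<Lambda> * \<kappa>)"
  proof -
    have "2 * \<Lambda> * \<kappa> = 4 * C * W / q" using pos by (simp add: \<Lambda>_def)
    then have "q * (1 + 4 * C * W / q) \<le> q * exp (2 * \<Lambda> * \<kappa>)"
      using pos by (intro mult_left_mono) auto
    moreover have "q * (1 + 4 * C * W / q) = 4 * C * W + q" using pos by (simp add: distrib_left)
    ultimately show ?thesis by simp
  qed
  have hw: "w holomorphic_on ball 0 1" using w by (simp add: H2_def)
  have main: "q / (C * exp 2) * exp (- (2 * \<Lambda>) * real K) \<le> (h2norm (\<lambda>z. w z * symbol z ^ j))\<^sup>2"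
    if K: "0 < K" "1 / (3 * (norm v)\<^sup>2) \<le> real K ^ 2" and j: "j \<le> 2 ^ (K\<^sup>2)"
      and H: "(\<lambda>z. w z * symbol z ^ j) \<in> H2" for K j
  proof -
    \<comment> \<open>The factor \<open>K\<^sup>2\<close> cancels the order
      \<open>1 / K\<^sup>2\<close> of the slit potential at \<open>- z0\<close>.\<close>
    define \<mu> where "\<mu> = \<Lambda> * real K ^ 2"
    define h where "h z = slit_potential (1 / real K) (- z)" for z
    define M where "M = exp (2 * \<mu> / real K + 2)"
    have lam: "0 \<le> \<mu>" using \<Lambda> by (simp add: \<mu>_def)
    define f where "f z = w z * exp (of_real \<mu> * slit_map (1 / real K) (- z))" for z
    have "(\<lambda>z. slit_map (1 / real K) (- z)) holomorphic_on ball 0 1"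
      by (rule holomorphic_on_compose_gen[OF _ slit_map_holomorphic, unfolded o_def])
         (auto intro!: holomorphic_intros)
    then have hf: "f holomorphic_on ball 0 1"
      unfolding f_def by (intro holomorphic_intros hw)
    have nf: "(norm (f z))\<^sup>2 = (norm (w z))\<^sup>2 * exp (2 * \<mu> * h z)" if "norm z < 1" for z
      using that by (simp add: f_def h_def norm_mult power_mult_distrib slit_potential_ball exp_double[symmetric] mult.assoc)
    obtain r0 where r0: "r0 < 1" "\<And>z. r0 \<le> norm z \<Longrightarrow> norm z < 1 \<Longrightarrow>
      exp (2 * \<mu> * h z) \<le> 2 + M * exp (- 2 * 2 ^ (K\<^sup>2) * symbol_potential z)"
      unfolding h_def M_def using slit_weight_annulus_bound[OF K(1) lam] by blast
    \<comment> \<open>The radius lies in the annulus of the weight bound and at least halfway from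
      \<open>z0\<close> to the circle, which yields
      \<open>r / (r - norm z0) \<le> C\<close>.\<close>
    define r where "r = max r0 ((1 + norm z0) / 2)"
    have r: "r < 1" "norm z0 < r" "r0 \<le> r" "(1 + norm z0) / 2 \<le> r" 
      using r0(1) z0 by (auto simp: r_def less_max_iff_disj)
    have rp: "0 \<le> r" using r(2) norm_ge_zero[of z0] by linarith
    have rC: "r / (r - norm z0) \<le> C"
    proof -
      have "r / (r - norm z0) \<le> 1 / ((1 - norm z0) / 2)"
        using r z0 rp by (intro frac_le) auto
      then show ?thesis by (simp add: C_def)
    qed
    have cw: "continuous_on (ball 0 1) (\<lambda>z. (norm (w z))\<^sup>2)"
      by (intro continuous_intros holomorphic_on_imp_continuous_on hw)
    have cws: "continuous_on (ball 0 1) (\<lambda>z. (norm (w z * symbol z ^ j))\<^sup>2)"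
      by (intro continuous_intros holomorphic_on_imp_continuous_on hw symbol_holomorphic)
    have "circle_mean r (\<lambda>z. (norm (f z))\<^sup>2) \<le>
        circle_mean r (\<lambda>z. 2 * (norm (w z))\<^sup>2 + M * (norm (w z * symbol z ^ j))\<^sup>2)"
    proof (rule circle_mean_mono)
      fix z :: complex assume nz: "norm z = r"
      with r have z1: "norm z < 1" by simp
      have "real j * symbol_potential z \<le> 2 ^ (K\<^sup>2) * symbol_potential z"
        using of_nat_mono[OF j, where 'a = real] symbol_potential_pos[OF z1] by (intro mult_right_mono) auto
      then have "exp (- 2 * 2 ^ (K\<^sup>2) * symbol_potential z) \<le> exp (- 2 * (real j * symbol_potential z))"
        by simp
      also have "\<dots> = (norm (symbol z ^ j))\<^sup>2"
        using z1 by (simp add: norm_power norm_symbol exp_of_nat_mult[symmetric] exp_double[symmetric])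
      finally have "M * exp (- 2 * 2 ^ (K\<^sup>2) * symbol_potential z) \<le> M * (norm (symbol z ^ j))\<^sup>2"
        by (rule mult_left_mono) (simp add: M_def)
      with r0(2)[of z] nz r(3) z1 have "exp (2 * \<mu> * h z) \<le> 2 + M * (norm (symbol z ^ j))\<^sup>2"
        by linarith
      then have "(norm (w z))\<^sup>2 * exp (2 * \<mu> * h z) \<le> (norm (w z))\<^sup>2 * (2 + M * (norm (symbol z ^ j))\<^sup>2)"
        by (intro mult_left_mono) auto
      then show "(norm (f z))\<^sup>2 \<le> 2 * (norm (w z))\<^sup>2 + M * (norm (w z * symbol z ^ j))\<^sup>2"
        using z1 by (simp add: nf norm_mult power_mult_distrib algebra_simps)
    qed (use r rp in \<open>auto intro!: continuous_intros cw cws holomorphic_on_imp_continuous_on[OF hf]\<close>)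
    also have "\<dots> = 2 * circle_mean r (\<lambda>z. (norm (w z))\<^sup>2) + M * circle_mean r (\<lambda>z. (norm (w z * symbol z ^ j))\<^sup>2)"
      by (rule circle_mean_add_cmult[OF cw cws rp r(1)])
    also have "\<dots> \<le> 2 * W + M * (h2norm (\<lambda>z. w z * symbol z ^ j))\<^sup>2"
      unfolding W_def
      by (intro add_mono mult_left_mono circle_mean_le_h2norm w H rp r(1)) (auto simp: M_def)
    finally have cm: "circle_mean r (\<lambda>z. (norm (f z))\<^sup>2) \<le> 2 * W + M * (h2norm (\<lambda>z. w z * symbol z ^ j))\<^sup>2" .
    have cm0: "0 \<le> circle_mean r (\<lambda>z. (norm (f z))\<^sup>2)"
      unfolding circle_mean_def by (rule integral_nonneg)
        (auto intro!: integrable_continuous_real continuous_intros continuous_on_circlepath_compose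
           holomorphic_on_imp_continuous_on hf rp r(1))
    have "\<kappa> / real K ^ 2 \<le> h z0"
    proof -
      have "(1 / real K)\<^sup>2 \<le> 3 * (norm v)\<^sup>2"
        using K m by (simp add: field_simps)
      then show ?thesis
        using slit_potential_lower_bound[of "- z0" "1 / real K"] z0
        by (simp add: h_def \<kappa>_def v_def power_divide mult.commute)
    qed
    then have "\<mu> * (\<kappa> / real K ^ 2) \<le> \<mu> * h z0" using lam by (rule mult_left_mono)
    then have "2 * \<Lambda> * \<kappa> \<le> 2 * \<mu> * h z0" using K(1) by (simp add: \<mu>_def)
    then have "q * exp (2 * \<Lambda> * \<kappa>) \<le> q * exp (2 * \<mu> * h z0)" using pos by simp
    also have "\<dots> = (norm (f z0))\<^sup>2" using nf[OF z0(1)] by (simp add: q_def)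
    also have "\<dots> \<le> r / (r - norm z0) * circle_mean r (\<lambda>z. (norm (f z))\<^sup>2)"
      by (rule norm_squared_le_circle_mean[OF hf r(2,1)])
    also have "\<dots> \<le> C * (2 * W + M * (h2norm (\<lambda>z. w z * symbol z ^ j))\<^sup>2)"
      using pos by (intro mult_mono rC cm cm0) auto
    finally have "4 * C * W + q \<le> 2 * (C * W) + C * M * (h2norm (\<lambda>z. w z * symbol z ^ j))\<^sup>2"
      using q\<Lambda> by (simp add: algebra_simps)
    moreover have "0 \<le> C * W" using pos by simp
    ultimately have qq: "q \<le> C * M * (h2norm (\<lambda>z. w z * symbol z ^ j))\<^sup>2" by linarith
    have "M = exp 2 * exp (2 * \<Lambda> * real K)"
      using K(1) by (simp add: M_def \<mu>_def exp_add[symmetric] power2_eq_square)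
    then have "q / (C * exp 2) * exp (- (2 * \<Lambda>) * real K) = q / (C * M)"
      by (simp add: exp_minus field_simps)
    also have "\<dots> \<le> (h2norm (\<lambda>z. w z * symbol z ^ j))\<^sup>2"
      using qq pos by (simp add: divide_le_eq M_def mult.commute)
    finally show ?thesis .
  qed
  \<comment> \<open>For large \<open>K\<close>, the slit \<open>1 / K\<close> meets the hypothesis
    of \<open>slit_potential_lower_bound\<close> at \<open>- z0\<close>.\<close>
  have "filterlim (\<lambda>K. real K ^ 2) at_top sequentially" by real_asymp
  then have "eventually (\<lambda>K. 1 / (3 * (norm v)\<^sup>2) \<le> real K ^ 2) sequentially"
    by (simp add: filterlim_at_top)
  with eventually_gt_at_top[of 0]
  have "eventually (\<lambda>K. \<forall>j \<le> 2 ^ (K\<^sup>2). (\<lambda>z. w z * symbol z ^ j) \<in> H2 \<longrightarrow>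
       q / (C * exp 2) * exp (- (2 * \<Lambda>) * real K) \<le> (h2norm (\<lambda>z. w z * symbol z ^ j))\<^sup>2) sequentially"
    by eventually_elim (use main in blast)
  then show ?thesis using that[of "q / (C * exp 2)" "2 * \<Lambda>"] pos \<Lambda> by simp
qed

text \<open>With \<open>N = 2 ^ (K\<^sup>2)\<close>, about
  \<open>N * \<beta> K / (2 * C\<^sup>2)\<close> singular numbers are at least
  \<open>sqrt (\<beta> K / 2)\<close>. Since \<open>\<beta> K\<close> decays only exponentially in
  \<open>K\<close>, the sum of their \<open>p\<close>-th powers grows like the exponential of a
  quadratic in \<open>K\<close>, for every \<open>p > 0\<close>.\<close>

lemma not_schatten_wcomp_symbol:
  assumes w: "w \<in> H2" and z0: "z0 \<in> ball 0 1" "w z0 \<noteq> 0"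
    and T: "H2_bounded_op (wcomp w symbol)" and p: "0 < p"
  shows "\<not> schatten p (wcomp w symbol)"
proof
  let ?T = "wcomp w symbol"
  assume "schatten p ?T"
  then have sm: "summable (\<lambda>n. sing_num ?T n powr p)" by (simp add: schatten_def)
  define S where "S = (\<Sum>n. sing_num ?T n powr p)"
  have Tz: "?T (\<lambda>z. z ^ j) = (\<lambda>z. w z * symbol z ^ j)" for j by (simp add: wcomp_def)
  have TH: "(\<lambda>z. w z * symbol z ^ j) \<in> H2" for j
    using H2_bounded_op_H2[OF T power_H2[of j]] by (simp add: Tz)
  obtain C where C: "0 < C" "\<And>f. f \<in> H2 \<Longrightarrow> h2norm (?T f) \<le> C * h2norm f"
    using H2_bounded_op_pos_bound[OF T] by blast
  obtain c L where c: "0 < c" "0 \<le> L"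
    and ev: "eventually (\<lambda>K. \<forall>j \<le> 2 ^ (K\<^sup>2). (\<lambda>z. w z * symbol z ^ j) \<in> H2 \<longrightarrow>
       c * exp (- L * real K) \<le> (h2norm (\<lambda>z. w z * symbol z ^ j))\<^sup>2) sequentially"
    using h2norm_weight_times_symbol_power_ge[OF w _ z0(2)] z0(1) by auto
  define \<beta> where "\<beta> K = c * exp (- L * real K)" for K :: nat
  have \<beta>: "0 < \<beta> K" for K using c by (simp add: \<beta>_def)
  have "eventually (\<lambda>K. 2 ^ (K\<^sup>2) * \<beta> K / (2 * C\<^sup>2) * (\<beta> K / 2) powr (p / 2) \<le> S) sequentially"
    using ev
  proof eventually_elim
    case (elim K)
    define N :: nat where "N = 2 ^ (K\<^sup>2)"
    \<comment> \<open>Below this index the rank loss \<open>n * C\<^sup>2 / N\<close> takes at most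
      half of \<open>\<beta> K\<close>.\<close>
    define x where "x = real N * \<beta> K / (2 * C\<^sup>2)"
    have N: "0 < N" by (simp add: N_def)
    have sn: "(\<beta> K / 2) powr (p / 2) \<le> sing_num ?T n powr p" if "n < nat \<lceil>x\<rceil>" for n
    proof -
      have "real n < x" using that by linarith
      then have "real n * C\<^sup>2 / real N \<le> \<beta> K / 2" using C(1) N by (simp add: x_def field_simps)
      then have "sqrt (\<beta> K / 2) \<le> sqrt (\<beta> K - real n * C\<^sup>2 / real N)" by simp
      also have "\<dots> \<le> sing_num ?T n"
        by (rule sqrt_le_sing_num[OF T less_imp_le[OF C(1)] C(2) N])
           (use elim TH in \<open>auto simp: Tz \<beta>_def N_def\<close>)
      finally have "sqrt (\<beta> K / 2) powr p \<le> sing_num ?T n powr p"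
        using \<beta>[of K] p by (intro powr_mono2) auto
      then show ?thesis using \<beta>[of K] by (simp add: powr_half_sqrt[symmetric] powr_powr)
    qed
    have "x * (\<beta> K / 2) powr (p / 2) \<le> real (nat \<lceil>x\<rceil>) * (\<beta> K / 2) powr (p / 2)"
      by (intro mult_right_mono real_nat_ceiling_ge) auto
    also have "\<dots> \<le> (\<Sum>n<nat \<lceil>x\<rceil>. sing_num ?T n powr p)"
      using sum_mono[of "{..<nat \<lceil>x\<rceil>}" "\<lambda>_. (\<beta> K / 2) powr (p / 2)" "\<lambda>n. sing_num ?T n powr p"] sn by simp
    also have "\<dots> \<le> S" unfolding S_def by (rule sum_le_suminf[OF sm]) auto
    finally show ?case by (simp add: x_def N_def)
  qed
  moreover have "filterlim (\<lambda>K. 2 ^ (K\<^sup>2) * \<beta> K / (2 * C\<^sup>2) * (\<beta> K / 2) powr (p / 2)) at_top sequentially"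
  proof -
    define D where "D = c / (2 * C\<^sup>2) * (c / 2) powr (p / 2)"
    define E where "E = L * (1 + p / 2)"
    have D: "0 < D" using c C by (simp add: D_def)
    have "2 ^ (K\<^sup>2) * \<beta> K / (2 * C\<^sup>2) * (\<beta> K / 2) powr (p / 2) = D * exp (ln 2 * real K ^ 2 - E * real K)" for K
    proof -
      have "(2::real) ^ (K\<^sup>2) = exp (ln 2 * real K ^ 2)"
        using exp_of_nat_mult[of "K\<^sup>2" "ln (2::real)"] by (simp add: mult.commute)
      moreover have "(\<beta> K / 2) powr (p / 2) = (c / 2) powr (p / 2) * exp (- (L * (p / 2) * real K))"
      proof -
        have "(\<beta> K / 2) powr (p / 2) = (c / 2) powr (p / 2) * exp (- L * real K) powr (p / 2)"
          using c powr_mult[of "c / 2" "exp (- L * real K)" "p / 2"] by (simp add: \<beta>_def)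
        also have "exp (- L * real K) powr (p / 2) = exp (- (L * (p / 2) * real K))"
          by (simp add: powr_def)
        finally show ?thesis .
      qed
      ultimately show ?thesis
        by (simp add: \<beta>_def D_def E_def exp_diff exp_minus exp_add algebra_simps) (simp add: field_simps)
    qed
    moreover have "filterlim (\<lambda>K::nat. D * exp (ln 2 * real K ^ 2 - E * real K)) at_top sequentially"
      using D by real_asymp
    ultimately show ?thesis by simp
  qed
  then have "eventually (\<lambda>K. S + 1 \<le> 2 ^ (K\<^sup>2) * \<beta> K / (2 * C\<^sup>2) * (\<beta> K / 2) powr (p / 2)) sequentially"
    by (simp add: filterlim_at_top)
  ultimately have "eventually (\<lambda>K::nat. False) sequentially" by eventually_elim simp
  then show False by simp
qed

theorem theorem4p7:
  shows "\<exists>\<phi>. \<phi> holomorphic_on ball 0 1 \<and> \<phi> ` ball 0 1 \<subseteq> ball 0 1 \<and>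
           unimodular_set \<phi> \<in> null_sets lebesgue \<and>
           (\<forall>w\<in>H2. (\<exists>z\<in>ball 0 1. w z \<noteq> 0) \<longrightarrow> H2_bounded_op (wcomp w \<phi>) \<longrightarrow>
              (\<forall>p>0. \<not> schatten p (wcomp w \<phi>)))"
proof (intro exI[of _ symbol] conjI)
  show "symbol holomorphic_on ball 0 1" by (rule symbol_holomorphic)
  show "symbol ` ball 0 1 \<subseteq> ball 0 1"
    using symbol_potential_pos by (auto simp: norm_symbol)
  show "unimodular_set symbol \<in> null_sets lebesgue"
    using finite_subset[OF unimodular_set_symbol] by (simp add: finite_imp_null_set_lborel null_sets_completionI)
  show "\<forall>w\<in>H2. (\<exists>z\<in>ball 0 1. w z \<noteq> 0) \<longrightarrow> H2_bounded_op (wcomp w symbol) \<longrightarrow>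
      (\<forall>p>0. \<not> schatten p (wcomp w symbol))"
    using not_schatten_wcomp_symbol by blast
qed

end
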